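(* Let $0<r<1$, $k=\sqrt{1-r^2}$, $q=e^{-\pi K(r)/K(k)}$, and for integers $n\ge0$ let $\tilde\Phi_{r,n}(z)=\frac1\pi\int_0^\pi e^{-z\operatorname{dn}(K(k)\theta/\pi,k)}\cos(n\theta)\,d\theta$, $z\in\mathbb{C}$. Then for all integers $m\ge1$, $n\ge1$, $$\int_0^\infty\tilde\Phi_{r,m}(x)\,\tilde\Phi_{r,n}(x)\,\frac1x\,dx=\begin{cases}0,&m\ne n,\\[2pt]\dfrac1n\,\dfrac{1}{q^{-2n}-q^{2n}},&m=n.\end{cases}$$
   Context: $K(k)=\int_0^{\pi/2}(1-k^2\sin^2\theta)^{-1/2}d\theta$ is the complete elliptic integral of the first kind with modulus $k$, and $\operatorname{dn}(\cdot,k)$ is Jacobi's delta amplitude function with modulus $k$. *)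

theory Defs
  imports "HOL-Analysis.Analysis"
begin

text \<open>
  Throughout, \<open>k\<close> is the modulus (not the parameter \<open>m = k\<^sup>2\<close>), with \<open>\<bar>k\<bar> < 1\<close>.
  The interval integral is oriented, so \<open>elliptic_F\<close> is also meaningful for negative amplitude.
\<close>

definition elliptic_F :: "real \<Rightarrow> real \<Rightarrow> real" where
  "elliptic_F \<phi> k = (LBINT t=ereal 0..ereal \<phi>. 1 / sqrt (1 - k\<^sup>2 * (sin t)\<^sup>2))"

definition elliptic_K :: "real \<Rightarrow> real" where
  "elliptic_K k = elliptic_F (pi / 2) k"

text \<open>
  For \<open>\<bar>k\<bar> < 1\<close> the map \<open>\<phi> \<mapsto> elliptic_F \<phi> k\<close> is an increasing bijection of the reals, so the
  amplitude is its inverse. Only real arguments of \<open>dn\<close> are covered.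
\<close>

definition jacobi_am :: "real \<Rightarrow> real \<Rightarrow> real" where
  "jacobi_am u k = (THE \<phi>. elliptic_F \<phi> k = u)"

definition jacobi_dn :: "real \<Rightarrow> real \<Rightarrow> real" where
  "jacobi_dn u k = sqrt (1 - k\<^sup>2 * (sin (jacobi_am u k))\<^sup>2)"

definition Phi_tilde :: "real \<Rightarrow> nat \<Rightarrow> complex \<Rightarrow> complex" where
  "Phi_tilde r n z =
    (let k = sqrt (1 - r\<^sup>2) in
      1 / of_real pi *
      (LBINT \<theta>:{0..pi}.
        exp (- z * of_real (jacobi_dn (elliptic_K k * \<theta> / pi) k)) * of_real (cos (real n * \<theta>))))"

end

theory Submission
  imports Defs
begin

text \<open>
  Write \<open>f \<theta> = dn (K(k) \<theta> / pi)\<close> and \<open>\<kappa> = K(k) / pi\<close>. By Frullani's integral, the quantity in question is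
  \<open>-1 / pi\<^sup>2\<close> times the double integral of \<open>ln (f \<theta> + f \<phi>) cos (m \<phi>) cos (n \<theta>)\<close>. Put
  \<open>j t = \<integral> ln (1 + t f \<theta>) cos (n \<theta>) d\<theta>\<close> over \<open>[0, pi]\<close>, so that the inner integral is \<open>j (1 / f \<phi>)\<close>.
  Integrating by parts twice and using the differential equation of \<open>dn\<close>, one finds a second-order
  linear equation for \<open>j\<close> on \<open>t > -1\<close>. It has constant coefficients in suitable variables:

  \<^item> for \<open>t = 1 / f \<phi>\<close> it becomes \<open>V'' = -n\<^sup>2 V\<close>, so \<open>j (1 / f \<phi>)\<close> is \<open>U cos (n \<phi>)\<close> plus a constant, and
    orthogonality of the cosines leaves only the value of \<open>U\<close> to be found;

  \<^item> for \<open>t = sin x\<close> and \<open>w = F(x, r)\<close> it becomes \<open>U'' = \<nu>\<^sup>2 U\<close> with \<open>\<nu> = n / \<kappa>\<close>, so \<open>dj/dw\<close> is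
    \<open>\<nu> U sinh (\<nu> (w - K(r)))\<close> with the same \<open>U\<close>, read off at \<open>t = 1\<close>.

  As \<open>t\<close> tends to \<open>-1\<close>, \<open>w\<close> tends to \<open>-K(r)\<close>, while the integrand of \<open>dj/dw\<close> concentrates at
  \<open>\<theta> = 0\<close> and gives the limit \<open>pi / \<kappa>\<close>. This determines \<open>U\<close>.
\<close>

subsection \<open>Elliptic integral and amplitude\<close>

lemma elliptic_radicand_pos:
  fixes k x :: real
  assumes "k\<^sup>2 < 1"
  shows "0 < 1 - k\<^sup>2 * (sin x)\<^sup>2"
proof -
  have "k\<^sup>2 * (sin x)\<^sup>2 \<le> k\<^sup>2 * 1"
    by (intro mult_left_mono) (auto simp: abs_square_le_1)
  then show ?thesis using assms by linarith
qed

lemma elliptic_F_has_derivative: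
  assumes "k\<^sup>2 < 1"
  shows "((\<lambda>x. elliptic_F x k) has_real_derivative 1 / sqrt (1 - k\<^sup>2 * (sin x)\<^sup>2)) (at x)"
proof -
  define M where "M = \<bar>x\<bar> + 1"
  have pos: "0 < 1 - k\<^sup>2 * (sin t)\<^sup>2" for t
    by (rule elliptic_radicand_pos[OF assms])
  have "((\<lambda>u. LBINT t=ereal 0..ereal u. 1 / sqrt (1 - k\<^sup>2 * (sin t)\<^sup>2)) has_vector_derivative
      1 / sqrt (1 - k\<^sup>2 * (sin x)\<^sup>2)) (at x within {-M..M})"
    using pos
    by (intro interval_integral_FTC2[where c = 0] continuous_intros)
      (auto simp: M_def less_imp_neq[symmetric])
  moreover have "at x within {-M..M} = at x"
    by (rule at_within_interior) (auto simp: M_def)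
  ultimately show ?thesis
    by (simp add: elliptic_F_def has_real_derivative_iff_has_vector_derivative)
qed

lemma elliptic_F_0 [simp]: "elliptic_F 0 k = 0"
  by (simp add: elliptic_F_def)

text \<open>The integrand is even, so the sum of both sides has derivative zero. This gives the
  value \<open>- K(r)\<close> at \<open>- pi / 2\<close>, where the limit that fixes
  \<open>U\<close> is taken.\<close>

lemma elliptic_F_minus:
  assumes "k\<^sup>2 < 1"
  shows "elliptic_F (- x) k = - elliptic_F x k"
proof -
  have "((\<lambda>x. elliptic_F (- x) k + elliptic_F x k) has_real_derivative 0) (at x)" for x
  proof -
    have "((\<lambda>x. elliptic_F (- x) k) has_real_derivative
        1 / sqrt (1 - k\<^sup>2 * (sin (- x))\<^sup>2) * (- 1)) (at x)"
      by (rule DERIV_chain2[OF elliptic_F_has_derivative[OF assms]])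
        (auto intro!: derivative_eq_intros)
    from DERIV_add[OF this elliptic_F_has_derivative[OF assms]] show ?thesis by simp
  qed
  then have "elliptic_F (- x) k + elliptic_F x k = elliptic_F (- 0) k + elliptic_F 0 k"
    by (rule DERIV_isconst_all[rule_format])
  then show ?thesis by simp
qed

text \<open>The integrand is at least 1, so \<open>elliptic_F x k - x\<close> is nondecreasing. This
  single estimate yields injectivity, surjectivity and the positivity of
  \<open>elliptic_K\<close>.\<close>

lemma elliptic_F_mono_strong:
  assumes "k\<^sup>2 < 1" "x \<le> y"
  shows "y - x \<le> elliptic_F y k - elliptic_F x k"
proof -
  have "elliptic_F x k - x \<le> elliptic_F y k - y"
  proof (rule DERIV_nonneg_imp_nondecreasing[OF \<open>x \<le> y\<close>])
    fix z
    have "((\<lambda>x. elliptic_F x k - x) has_real_derivative 1 / sqrt (1 - k\<^sup>2 * (sin z)\<^sup>2) - 1) (at z)"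
      by (intro DERIV_diff elliptic_F_has_derivative assms(1) DERIV_ident)
    moreover have "sqrt (1 - k\<^sup>2 * (sin z)\<^sup>2) \<le> 1" by simp
    moreover have "0 < sqrt (1 - k\<^sup>2 * (sin z)\<^sup>2)"
      using elliptic_radicand_pos[OF assms(1)] by simp
    ultimately show "\<exists>y. ((\<lambda>x. elliptic_F x k - x) has_real_derivative y) (at z) \<and> 0 \<le> y"
      by (intro exI[of _ "1 / sqrt (1 - k\<^sup>2 * (sin z)\<^sup>2) - 1"]) (auto simp: field_simps)
  qed
  then show ?thesis by simp
qed

lemma isCont_elliptic_F: "k\<^sup>2 < 1 \<Longrightarrow> isCont (\<lambda>x. elliptic_F x k) x"
  using elliptic_F_has_derivative DERIV_isCont by blast

lemma elliptic_F_eq_iff: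
  assumes "k\<^sup>2 < 1"
  shows "elliptic_F x k = elliptic_F y k \<longleftrightarrow> x = y"
  using elliptic_F_mono_strong[OF assms, of x y] elliptic_F_mono_strong[OF assms, of y x]
  by (cases "x \<le> y") auto

lemma jacobi_am_elliptic_F: "k\<^sup>2 < 1 \<Longrightarrow> jacobi_am (elliptic_F x k) k = x"
  unfolding jacobi_am_def by (rule the_equality) (auto simp: elliptic_F_eq_iff)

lemma surj_elliptic_F:
  assumes "k\<^sup>2 < 1"
  obtains x where "elliptic_F x k = u"
proof -
  have "\<exists>x. -\<bar>u\<bar> \<le> x \<and> x \<le> \<bar>u\<bar> \<and> elliptic_F x k = u"
  proof (rule IVT)
    show "elliptic_F (- \<bar>u\<bar>) k \<le> u"
      using elliptic_F_mono_strong[OF assms, of "-\<bar>u\<bar>" 0] by simp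
    show "u \<le> elliptic_F \<bar>u\<bar> k"
      using elliptic_F_mono_strong[OF assms, of 0 "\<bar>u\<bar>"] by simp
  qed (auto simp: isCont_elliptic_F assms)
  then show ?thesis using that by blast
qed

text \<open>Inverse function rule: the derivative of \<open>elliptic_F\<close> at the amplitude is
  the reciprocal of dn.\<close>

lemma jacobi_am_has_derivative:
  assumes "k\<^sup>2 < 1"
  shows "((\<lambda>u. jacobi_am u k) has_real_derivative jacobi_dn u k) (at u)"
proof -
  obtain x where x: "elliptic_F x k = u" by (rule surj_elliptic_F[OF assms])
  have "((\<lambda>u. jacobi_am u k) has_real_derivative
      inverse (1 / sqrt (1 - k\<^sup>2 * (sin x)\<^sup>2))) (at u)"
  proof (rule DERIV_inverse_function)
    show "((\<lambda>x. elliptic_F x k) has_real_derivative 1 / sqrt (1 - k\<^sup>2 * (sin x)\<^sup>2))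
        (at (jacobi_am u k))"
      using elliptic_F_has_derivative[OF assms, of x]
      by (simp add: x[symmetric] jacobi_am_elliptic_F assms)
    show "1 / sqrt (1 - k\<^sup>2 * (sin x)\<^sup>2) \<noteq> 0"
      using elliptic_radicand_pos[OF assms, of x] by simp
    show "elliptic_F (jacobi_am y k) k = y" for y
      by (rule surj_elliptic_F[OF assms, of y]) (auto simp: jacobi_am_elliptic_F assms)
    show "isCont (\<lambda>u. jacobi_am u k) u"
      unfolding x[symmetric]
      by (rule isCont_inverse_function[of 1])
        (auto simp: jacobi_am_elliptic_F isCont_elliptic_F assms)
    show "u - 1 < u" "u < u + 1" by auto
  qed
  then show ?thesis
    by (simp add: x[symmetric] jacobi_dn_def jacobi_am_elliptic_F assms)
qed

lemma elliptic_K_pos: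
  assumes "k\<^sup>2 < 1"
  shows "0 < elliptic_K k"
proof -
  have "0 < pi / 2" by simp
  also have "pi / 2 \<le> elliptic_K k"
    using elliptic_F_mono_strong[OF assms, of 0 "pi / 2"] by (simp add: elliptic_K_def)
  finally show ?thesis .
qed

subsection \<open>Elementary integrals and inequalities\<close>

lemma integral_cos_nat_0_pi:
  assumes "n \<ge> 1"
  shows "((\<lambda>\<theta>. cos (real n * \<theta>)) has_integral 0) {0..pi}"
proof -
  have "((\<lambda>\<theta>. cos (real n * \<theta>)) has_integral
      sin (real n * pi) / real n - sin (real n * 0) / real n) {0..pi}"
    using assms
    by (intro fundamental_theorem_of_calculus)
      (auto intro!: derivative_eq_intros simp: has_real_derivative_iff_has_vector_derivative[symmetric])
  then show ?thesis by simp
qed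

lemma integral_cos_cos_0_pi:
  assumes "m \<ge> 1" "n \<ge> 1"
  shows "((\<lambda>\<theta>. cos (real m * \<theta>) * cos (real n * \<theta>)) has_integral (if m = n then pi / 2 else 0)) {0..pi}"
proof -
  have 1: "((\<lambda>\<theta>. cos (real (m + n) * \<theta>)) has_integral 0) {0..pi}"
    using assms by (intro integral_cos_nat_0_pi) simp
  have 2: "((\<lambda>\<theta>. cos ((real m - real n) * \<theta>)) has_integral (if m = n then pi else 0)) {0..pi}"
  proof (cases m n rule: linorder_cases)
    case less
    \<comment> \<open>Cosine is even, so the sign can be flipped to reach \<open>n - m\<close>, a
      natural subtraction that does not truncate.\<close>
    then have "cos ((real m - real n) * \<theta>) = cos (real (n - m) * \<theta>)" for \<theta>
      by (subst cos_minus[symmetric]) (simp add: of_nat_diff algebra_simps)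
    then show ?thesis using less integral_cos_nat_0_pi[of "n - m"] by simp
  next
    case equal
    then show ?thesis using has_integral_const_real[of "1::real" 0 pi] by simp
  next
    case greater
    then show ?thesis using integral_cos_nat_0_pi[of "m - n"] by (simp add: of_nat_diff)
  qed
  have "((\<lambda>\<theta>. (cos ((real m - real n) * \<theta>) + cos (real (m + n) * \<theta>)) / 2) has_integral
      ((if m = n then pi else 0) + 0) / 2) {0..pi}"
    by (intro has_integral_divide has_integral_add 1 2)
  then show ?thesis by (auto simp: cos_times_cos algebra_simps)
qed

lemma LBINT_eq_integral:
  fixes g :: "real \<Rightarrow> real"
  assumes "continuous_on {a..b} g"
  shows "(LBINT x:{a..b}. g x) = integral {a..b} g"
  by (intro set_borel_integral_eq_integral(2) borel_integrable_atLeastAtMost' assms)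

text \<open>
  The antiderivative is \<open>arctan (a * tan x)\<close>, written by means of the addition theorem in a form that
  has no singularity at \<open>pi / 2\<close>.
\<close>

lemma arctan_scaled_tan_has_derivative:
  fixes a x :: real
  assumes a: "0 < a"
  shows "((\<lambda>x. x + arctan ((a - 1) * sin x * cos x / ((cos x)\<^sup>2 + a * (sin x)\<^sup>2)))
    has_real_derivative a / ((cos x)\<^sup>2 + a\<^sup>2 * (sin x)\<^sup>2)) (at x)"
proof -
  define M where "M x = (cos x)\<^sup>2 + a * (sin x)\<^sup>2" for x :: real
  define N where "N x = (a - 1) * sin x * cos x" for x :: real
  define D where "D = (cos x)\<^sup>2 + a\<^sup>2 * (sin x)\<^sup>2"
  have pos: "0 < (cos x)\<^sup>2 + b * (sin x)\<^sup>2" if "b > 0" for b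
    using that sin_cos_squared_add[of x]
    by (cases "sin x = 0") (auto simp: add_nonneg_pos)
  have M: "M x > 0" and D: "D > 0"
    using pos a by (auto simp: M_def D_def)
  \<comment> \<open>\<open>M x\<close> and \<open>N x\<close> are the real and imaginary parts of
    \<open>(cos x + i a sin x) (cos x - i sin x)\<close>. The second factor has modulus 1, so the
    squared modulus is \<open>D\<close>.\<close>
  have MN: "(M x)\<^sup>2 + (N x)\<^sup>2 = D"
  proof -
    have "(M x)\<^sup>2 + (N x)\<^sup>2 = ((sin x)\<^sup>2 + (cos x)\<^sup>2) * D"
      unfolding M_def N_def D_def by algebra
    then show ?thesis by simp
  qed
  have M': "(M has_real_derivative 2 * (a - 1) * sin x * cos x) (at x)"
    unfolding M_def by (auto intro!: derivative_eq_intros simp: algebra_simps)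
  have N': "(N has_real_derivative (a - 1) * ((cos x)\<^sup>2 - (sin x)\<^sup>2)) (at x)"
    unfolding N_def by (auto intro!: derivative_eq_intros simp: algebra_simps power2_eq_square)
  have "((\<lambda>x. x + arctan (N x / M x)) has_real_derivative
      1 + inverse (1 + (N x / M x)\<^sup>2) *
        (((a - 1) * ((cos x)\<^sup>2 - (sin x)\<^sup>2) * M x - N x * (2 * (a - 1) * sin x * cos x)) / (M x * M x))) (at x)"
    using M by (intro DERIV_add DERIV_ident DERIV_chain2[OF DERIV_arctan] DERIV_divide M' N') simp
  also have "inverse (1 + (N x / M x)\<^sup>2) = (M x)\<^sup>2 / D"
    unfolding MN[symmetric] using M by (simp add: divide_simps add_nonneg_eq_0_iff)
  also have "1 + (M x)\<^sup>2 / D *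
        (((a - 1) * ((cos x)\<^sup>2 - (sin x)\<^sup>2) * M x - N x * (2 * (a - 1) * sin x * cos x)) / (M x * M x))
      = (D + ((a - 1) * ((cos x)\<^sup>2 - (sin x)\<^sup>2) * M x - N x * (2 * (a - 1) * sin x * cos x))) / D"
    using M D by (simp add: field_simps power2_eq_square)
  also have "D + ((a - 1) * ((cos x)\<^sup>2 - (sin x)\<^sup>2) * M x - N x * (2 * (a - 1) * sin x * cos x)) = a"
    unfolding M_def N_def D_def using sin_cos_squared_add[of x] by algebra
  finally show ?thesis by (simp add: M_def N_def D_def)
qed

text \<open>Jordan's inequality: sine is concave and so lies above its chord from 0 to
  \<open>pi / 2\<close>.\<close>

lemma sin_ge_two_pi_mult:
  fixes x :: real
  assumes "0 \<le> x" "x \<le> pi / 2"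
  shows "2 / pi * x \<le> sin x"
proof -
  have "concave_on {0..pi} sin"
    by (rule f''_le0_imp_concave[where f' = cos and f'' = "\<lambda>x. - sin x"])
      (auto intro!: derivative_eq_intros sin_ge_zero)
  then have "(1 - 2 / pi * x) * sin 0 + 2 / pi * x * sin (pi / 2)
      \<le> sin ((1 - 2 / pi * x) *\<^sub>R 0 + (2 / pi * x) *\<^sub>R (pi / 2))"
    by (rule concave_onD) (use assms in \<open>auto simp: field_simps\<close>)
  then show ?thesis by simp
qed

section \<open>Frullani's integral and interchange of integrals\<close>

text \<open>The integrand is the integral of \<open>exp (- x * y)\<close> over \<open>y\<close> in
  \<open>{a..b}\<close>. After swapping, the inner integral over \<open>x\<close> is
  \<open>1 / y\<close>. With nonnegative integrals the swap is free of integrability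
  conditions.\<close>

lemma nn_integral_frullani_exp:
  fixes a b :: real
  assumes a: "0 < a" and ab: "a \<le> b"
  shows "(\<integral>\<^sup>+x\<in>{0<..}. ennreal ((exp (- a * x) - exp (- b * x)) / x) \<partial>lborel) = ennreal (ln (b / a))"
proof -
  let ?h = "\<lambda>x y::real. ennreal (exp (- x * y)) * indicator {a..b} y * indicator {0<..} x"
  have [measurable]: "(\<lambda>(x, y). ?h x y) \<in> borel_measurable (lborel \<Otimes>\<^sub>M lborel)"
    by measurable
  have "(\<integral>\<^sup>+x\<in>{0<..}. ennreal ((exp (- a * x) - exp (- b * x)) / x) \<partial>lborel)
      = (\<integral>\<^sup>+x. \<integral>\<^sup>+y. ?h x y \<partial>lborel \<partial>lborel)"
  proof (rule nn_integral_cong)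
    fix x :: real
    show "ennreal ((exp (- a * x) - exp (- b * x)) / x) * indicator {0<..} x = (\<integral>\<^sup>+y. ?h x y \<partial>lborel)"
    proof (cases "0 < x")
      case True
      have "(\<integral>\<^sup>+y\<in>{a..b}. ennreal (exp (- x * y)) \<partial>lborel)
          = ennreal ((- exp (- x * b) / x) - (- exp (- x * a) / x))"
        by (rule nn_integral_FTC_Icc) (use True ab in \<open>auto intro!: derivative_eq_intros\<close>)
      then show ?thesis using True by (simp add: diff_divide_distrib mult.commute)
    qed simp
  qed
  also have "\<dots> = (\<integral>\<^sup>+y. \<integral>\<^sup>+x. ?h x y \<partial>lborel \<partial>lborel)"
    by (rule lborel_pair.Fubini'[symmetric]) measurable
  also have "\<dots> = (\<integral>\<^sup>+y\<in>{a..b}. ennreal (1 / y) \<partial>lborel)"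
  proof (rule nn_integral_cong)
    fix y :: real
    show "(\<integral>\<^sup>+x. ?h x y \<partial>lborel) = ennreal (1 / y) * indicator {a..b} y"
    proof (cases "y \<in> {a..b}")
      case True
      then have y: "0 < y" using a by simp
      have "(\<integral>\<^sup>+x. ?h x y \<partial>lborel) = (\<integral>\<^sup>+x\<in>{0..}. ennreal (exp (- x * y)) \<partial>lborel)"
      \<comment> \<open>The open and the closed half-line differ only by the null set
        \<open>{0}\<close>.\<close>
      proof (rule nn_integral_cong_AE)
        show "AE x in lborel. ?h x y = ennreal (exp (- x * y)) * indicator {0..} x"
          using AE_lborel_singleton[of 0] by eventually_elim (use True in \<open>auto split: split_indicator\<close>)
      qed
      also have "\<dots> = ennreal (0 - (- exp (- 0 * y) / y))"
      proof (rule nn_integral_FTC_atLeast)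
        show "((\<lambda>x. - exp (- x * y) / y) \<longlongrightarrow> 0) at_top"
          using y by real_asymp
      qed (use y in \<open>auto intro!: derivative_eq_intros\<close>)
      finally show ?thesis using True by simp
    qed simp
  qed
  also have "\<dots> = ennreal (ln b - ln a)"
    by (rule nn_integral_FTC_Icc) (use a ab in \<open>auto intro!: derivative_eq_intros\<close>)
  finally show ?thesis using a ab by (simp add: ln_div)
qed

lemma frullani_exp:
  fixes a b :: real
  assumes a: "0 < a" and ab: "a \<le> b"
  shows "(LBINT x:{0<..}. (exp (- a * x) - exp (- b * x)) / x) = ln (b / a)"
proof -
  have "(LBINT x:{0<..}. (exp (- a * x) - exp (- b * x)) / x)
      = enn2real (\<integral>\<^sup>+x. ennreal (indicator {0<..} x *\<^sub>R ((exp (- a * x) - exp (- b * x)) / x)) \<partial>lborel)"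
    unfolding set_lebesgue_integral_def
    by (rule integral_eq_nn_integral) (use ab in \<open>auto split: split_indicator intro!: AE_I2 divide_nonneg_nonneg\<close>)
  also have "(\<integral>\<^sup>+x. ennreal (indicator {0<..} x *\<^sub>R ((exp (- a * x) - exp (- b * x)) / x)) \<partial>lborel)
      = ennreal (ln (b / a))"
    unfolding nn_integral_frullani_exp[OF assms, symmetric]
    by (intro nn_integral_cong) (auto split: split_indicator)
  finally show ?thesis using a ab by simp
qed

lemma set_integrable_exp_neg:
  fixes r :: real
  assumes "0 < r"
  shows "set_integrable lborel {0<..} (\<lambda>x. exp (- r * x))"
proof -
  have "(\<integral>\<^sup>+x\<in>{0..}. ennreal (exp (- r * x)) \<partial>lborel) = ennreal (0 - (- exp (- r * 0) / r))"
  proof (rule nn_integral_FTC_atLeast)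
    show "((\<lambda>x. - exp (- r * x) / r) \<longlongrightarrow> 0) at_top" using assms by real_asymp
  qed (use assms in \<open>auto intro!: derivative_eq_intros\<close>)
  then have "(\<integral>\<^sup>+x\<in>{0..}. ennreal (exp (- r * x)) \<partial>lborel) < \<infinity>" by simp
  moreover have "(\<lambda>x::real. ennreal (exp (- r * x)) * indicator {0..} x) = (\<lambda>x. ennreal (norm (indicator {0..} x *\<^sub>R exp (- r * x))))"
    by (auto split: split_indicator)
  ultimately have "set_integrable lborel {0..} (\<lambda>x. exp (- r * x))"
    unfolding set_integrable_def by (intro integrableI_bounded) simp_all
  then show ?thesis by (rule set_integrable_subset) auto
qed

text \<open>The majorant \<open>G\<close> is a product of an integrable function of \<open>x\<close>
  and a bounded function of \<open>y\<close> on a bounded interval, so it is integrable on the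
  product space and Fubini applies to \<open>h\<close>. Both later interchanges have this
  shape.\<close>

lemma Fubini_exp_bound:
  fixes h :: "real \<Rightarrow> real \<Rightarrow> real" and r C L :: real
  assumes [measurable]: "(\<lambda>(x, y). h x y) \<in> borel_measurable (lborel \<Otimes>\<^sub>M lborel)"
    and r: "0 < r"
    and bound: "\<And>x y. 0 < x \<Longrightarrow> y \<in> {0..L} \<Longrightarrow> \<bar>h x y\<bar> \<le> C * exp (- r * x)"
  shows "set_integrable lborel {0<..} (\<lambda>x. LBINT y:{0..L}. h x y)"
    and "(LBINT x:{0<..}. LBINT y:{0..L}. h x y) = (LBINT y:{0..L}. LBINT x:{0<..}. h x y)"
proof -
  define H where "H x y = indicator {0<..} x * indicator {0..L} y * h x y" for x y :: real
  have Hm [measurable]: "(\<lambda>(x, y). H x y) \<in> borel_measurable (lborel \<Otimes>\<^sub>M lborel)"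
    unfolding H_def by measurable
  define G where "G x y = (indicator {0<..} x * exp (- r * x)) * (C * indicator {0..L} y)" for x y :: real
  have Gm [measurable]: "(\<lambda>(x, y). G x y) \<in> borel_measurable (lborel \<Otimes>\<^sub>M lborel)"
    unfolding G_def by measurable
  have dom: "integrable (lborel \<Otimes>\<^sub>M lborel) (\<lambda>(x, y). G x y)"
  proof (rule lborel_pair.Fubini_integrable[OF Gm])
    show "AE x in lborel. integrable lborel (\<lambda>y. case (x, y) of (x, y) \<Rightarrow> G x y)"
      by (auto simp: G_def emeasure_lborel_Icc_eq
          intro!: AE_I2 integrable_mult_right integrable_real_indicator)
    have "integrable lborel (\<lambda>x. (indicator {0<..} x * exp (- r * x)) * (LBINT y. \<bar>C * indicator {0..L} y\<bar>))"
      using set_integrable_exp_neg[OF r] by (intro integrable_mult_left) (simp add: set_integrable_def)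
    then show "integrable lborel (\<lambda>x. LBINT y. norm (case (x, y) of (x, y) \<Rightarrow> G x y))"
      by (simp add: G_def abs_mult)
  qed
  have int: "integrable (lborel \<Otimes>\<^sub>M lborel) (\<lambda>(x, y). H x y)"
  proof (rule Bochner_Integration.integrable_bound[OF dom Hm], rule AE_I2)
    fix z :: "real \<times> real"
    obtain x y where z: "z = (x, y)" by (cases z)
    show "norm (case z of (x, y) \<Rightarrow> H x y) \<le>
        norm (case z of (x, y) \<Rightarrow> G x y)"
    proof (cases "0 < x \<and> y \<in> {0..L}")
      case True
      then have "\<bar>h x y\<bar> \<le> C * exp (- r * x)" using bound by blast
      also have "\<dots> \<le> \<bar>exp (- r * x) * C\<bar>" by (simp add: mult.commute)
      finally show ?thesis using True by (simp add: z H_def G_def)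
    qed (auto simp: z H_def split: split_indicator)
  qed
  have e1: "(LBINT y. H x y) = indicator {0<..} x *\<^sub>R (LBINT y:{0..L}. h x y)" for x
    by (simp add: H_def set_lebesgue_integral_def mult.assoc)
  have e2: "(LBINT x. H x y) = indicator {0..L} y *\<^sub>R (LBINT x:{0<..}. h x y)" for y
  proof -
    have "H x y = indicator {0..L} y * (indicator {0<..} x * h x y)" for x
      by (simp add: H_def)
    then show ?thesis by (simp add: set_lebesgue_integral_def)
  qed
  show "set_integrable lborel {0<..} (\<lambda>x. LBINT y:{0..L}. h x y)"
    using lborel_pair.integrable_fst[OF int] by (simp add: e1 set_integrable_def)
  show "(LBINT x:{0<..}. LBINT y:{0..L}. h x y) = (LBINT y:{0..L}. LBINT x:{0<..}. h x y)"
    using lborel_pair.Fubini_integral[OF int]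
    unfolding e1 e2 by (simp add: set_lebesgue_integral_def[of lborel "{0<..}" "\<lambda>x. LBINT y:{0..L}. h x y"]
        set_lebesgue_integral_def[of lborel "{0..L}" "\<lambda>y. LBINT x:{0<..}. h x y"])
qed

subsection \<open>The logarithmic integral of dn\<close>

locale complementary_moduli =
  fixes r k :: real
  assumes r_pos: "0 < r" and r_less_1: "r < 1" and k_eq: "k = sqrt (1 - r\<^sup>2)"
begin

lemma r2_less_1: "r\<^sup>2 < 1"
  using r_pos r_less_1 by (simp add: power_less_one_iff abs_square_less_1)

lemma k2_eq: "k\<^sup>2 = 1 - r\<^sup>2"
  using r2_less_1 by (simp add: k_eq)

lemma r2_eq: "r\<^sup>2 = 1 - k\<^sup>2"
  by (simp add: k2_eq)

lemma k2_less_1: "k\<^sup>2 < 1"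
  using r_pos by (simp add: k2_eq)

text \<open>Scales the argument so that \<open>\<theta> = pi\<close> corresponds to
  \<open>K(k)\<close>, which is half a period of dn.\<close>

definition \<kappa> :: real where "\<kappa> = elliptic_K k / pi"

lemma \<kappa>_pos: "0 < \<kappa>"
  by (simp add: \<kappa>_def elliptic_K_pos k2_less_1)

definition \<alpha> :: "real \<Rightarrow> real" where "\<alpha> \<theta> = jacobi_am (\<kappa> * \<theta>) k"

definition f :: "real \<Rightarrow> real" where "f \<theta> = jacobi_dn (\<kappa> * \<theta>) k"

text \<open>The sine and cosine of \<open>\<alpha> \<theta>\<close> are sn and cn at
  \<open>\<kappa> * \<theta>\<close>, so this is dn' = - k^2 sn cn with the chain rule factor
  \<open>\<kappa>\<close>.\<close>

definition f' :: "real \<Rightarrow> real" where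
  "f' \<theta> = - (\<kappa> * k\<^sup>2 * sin (\<alpha> \<theta>) * cos (\<alpha> \<theta>))"

lemma f_\<alpha>: "f \<theta> = sqrt (1 - k\<^sup>2 * (sin (\<alpha> \<theta>))\<^sup>2)"
  by (simp add: f_def \<alpha>_def jacobi_dn_def)

lemma f_squared: "(f \<theta>)\<^sup>2 = 1 - k\<^sup>2 * (sin (\<alpha> \<theta>))\<^sup>2"
  using elliptic_radicand_pos[OF k2_less_1, of "\<alpha> \<theta>"] by (simp add: f_\<alpha>)

lemma f_pos: "0 < f \<theta>"
  using elliptic_radicand_pos[OF k2_less_1, of "\<alpha> \<theta>"] by (simp add: f_\<alpha>)

lemma f_le_1: "f \<theta> \<le> 1"
  by (simp add: f_\<alpha>)

lemma f_ge_r: "r \<le> f \<theta>"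
proof (rule power2_le_imp_le)
  have "k\<^sup>2 * (sin (\<alpha> \<theta>))\<^sup>2 \<le> k\<^sup>2 * 1"
    by (intro mult_left_mono) (auto simp: abs_square_le_1)
  then show "r\<^sup>2 \<le> (f \<theta>)\<^sup>2" by (simp add: f_squared k2_eq)
qed (use f_pos less_imp_le in blast)

lemma \<alpha>_has_derivative: "(\<alpha> has_real_derivative \<kappa> * f \<theta>) (at \<theta>)"
proof -
  have "((\<lambda>\<theta>. jacobi_am (\<kappa> * \<theta>) k) has_real_derivative jacobi_dn (\<kappa> * \<theta>) k * \<kappa>) (at \<theta>)"
    by (rule DERIV_chain2[OF jacobi_am_has_derivative[OF k2_less_1]])
      (auto intro!: derivative_eq_intros)
  then show ?thesis by (simp add: \<alpha>_def[abs_def] f_def mult.commute)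
qed

lemma \<alpha>_0: "\<alpha> 0 = 0"
  using jacobi_am_elliptic_F[OF k2_less_1, of 0] by (simp add: \<alpha>_def)

lemma \<alpha>_pi: "\<alpha> pi = pi / 2"
  using jacobi_am_elliptic_F[OF k2_less_1, of "pi / 2"] by (simp add: \<alpha>_def \<kappa>_def elliptic_K_def)

lemma f_0: "f 0 = 1" and f'_0: "f' 0 = 0" and f'_pi: "f' pi = 0"
  by (simp_all add: f_\<alpha> f'_def \<alpha>_0 \<alpha>_pi)

lemma f_has_derivative: "(f has_real_derivative f' \<theta>) (at \<theta>)"
proof -
  have pos: "0 < 1 - k\<^sup>2 * (sin (\<alpha> \<theta>))\<^sup>2"
    by (rule elliptic_radicand_pos[OF k2_less_1])
  have "((\<lambda>\<theta>. 1 - k\<^sup>2 * (sin (\<alpha> \<theta>))\<^sup>2) has_real_derivative 2 * f \<theta> * f' \<theta>) (at \<theta>)"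
    by (auto intro!: derivative_eq_intros \<alpha>_has_derivative simp: f'_def)
  from DERIV_chain2[OF DERIV_real_sqrt[OF pos] this]
  have "((\<lambda>\<theta>. sqrt (1 - k\<^sup>2 * (sin (\<alpha> \<theta>))\<^sup>2)) has_real_derivative
      inverse (f \<theta>) / 2 * (2 * f \<theta> * f' \<theta>)) (at \<theta>)"
    by (simp only: f_\<alpha>[symmetric])
  moreover have "inverse (f \<theta>) / 2 * (2 * f \<theta> * f' \<theta>) = f' \<theta>"
    using f_pos[of \<theta>] by simp
  moreover have "(\<lambda>\<theta>. sqrt (1 - k\<^sup>2 * (sin (\<alpha> \<theta>))\<^sup>2)) = f"
    by (simp add: f_\<alpha> fun_eq_iff)
  ultimately show ?thesis by (simp only:)
qed

text \<open>The second-order equation dn'' = (2 - k^2) dn - 2 dn^3 with the argument rescaled; here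
  2 - k^2 = 1 + r^2.\<close>

lemma f'_has_derivative:
  "(f' has_real_derivative \<kappa>\<^sup>2 * ((1 + r\<^sup>2) * f \<theta> - 2 * f \<theta> ^ 3)) (at \<theta>)"
proof -
  have eq: "(cos (\<alpha> \<theta>))\<^sup>2 = 1 - (sin (\<alpha> \<theta>))\<^sup>2"
    by (simp add: cos_squared_eq)
  have "(1 + r\<^sup>2) * f \<theta> - 2 * f \<theta> ^ 3 = f \<theta> * (1 + r\<^sup>2 - 2 * (f \<theta>)\<^sup>2)"
    by (simp add: algebra_simps power3_eq_cube power2_eq_square)
  also have "\<dots> = - k\<^sup>2 * ((cos (\<alpha> \<theta>))\<^sup>2 - (sin (\<alpha> \<theta>))\<^sup>2) * f \<theta>"
    unfolding f_squared eq by (simp add: k2_eq algebra_simps)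
  finally have *: "(1 + r\<^sup>2) * f \<theta> - 2 * f \<theta> ^ 3
      = - k\<^sup>2 * ((cos (\<alpha> \<theta>))\<^sup>2 - (sin (\<alpha> \<theta>))\<^sup>2) * f \<theta>" .
  show ?thesis
    unfolding f'_def[abs_def] *
    by (auto intro!: derivative_eq_intros \<alpha>_has_derivative simp: algebra_simps power2_eq_square)
qed

text \<open>The quartic factors as (1 - f^2) (f^2 - r^2), and the two factors are k^2 sn^2 and k^2
  cn^2.\<close>

lemma f'_squared: "(f' \<theta>)\<^sup>2 = \<kappa>\<^sup>2 * (- (f \<theta> ^ 4) + (1 + r\<^sup>2) * (f \<theta>)\<^sup>2 - r\<^sup>2)"
proof -
  have "- (f \<theta> ^ 4) + (1 + r\<^sup>2) * (f \<theta>)\<^sup>2 - r\<^sup>2 = (1 - (f \<theta>)\<^sup>2) * ((f \<theta>)\<^sup>2 - r\<^sup>2)"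
    by (simp add: algebra_simps power2_eq_square power4_eq_xxxx)
  also have "\<dots> = (k\<^sup>2)\<^sup>2 * (sin (\<alpha> \<theta>))\<^sup>2 * (cos (\<alpha> \<theta>))\<^sup>2"
    unfolding f_squared cos_squared_eq r2_eq by (simp add: algebra_simps power2_eq_square)
  finally show ?thesis by (simp add: f'_def power_mult_distrib)
qed

lemma continuous_f [continuous_intros]:
  "continuous_on A g \<Longrightarrow> continuous_on A (\<lambda>x. f (g x))"
  by (rule continuous_on_compose2[of UNIV f])
    (auto intro!: continuous_at_imp_continuous_on DERIV_isCont[OF f_has_derivative])

section \<open>The parameter integral \<open>j\<close> and its differential equation\<close>

lemma one_plus_f_pos: "-1 < t \<Longrightarrow> 0 < 1 + t * f \<theta>"
proof (cases "0 \<le> t")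
  case True
  then show ?thesis using f_pos[of \<theta>] by (simp add: add_pos_nonneg)
next
  case False
  assume "-1 < t"
  \<comment> \<open>For negative \<open>t\<close> the worst case is the maximum
    \<open>f \<theta> = 1\<close>, attained at \<open>\<theta> = 0\<close>; this is why
    \<open>t\<close> is bounded below by -1.\<close>
  then have "- t * f \<theta> \<le> - t * 1" using False f_le_1 by (intro mult_left_mono) auto
  then show ?thesis using \<open>-1 < t\<close> by simp
qed

text \<open>
  The parameter is \<open>t = 1 / c\<close> rather than the \<open>c\<close> of \<open>ln (c + f \<theta>)\<close>, so that \<open>c\<close> may pass
  through infinity; the term \<open>ln c\<close> lost in this way is orthogonal to \<open>cos (n \<theta>)\<close>.
\<close>

definition j :: "nat \<Rightarrow> real \<Rightarrow> real" where
  "j n t = integral {0..pi} (\<lambda>\<theta>. ln (1 + t * f \<theta>) * cos (real n * \<theta>))"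

definition j' :: "nat \<Rightarrow> real \<Rightarrow> real" where
  "j' n t = integral {0..pi} (\<lambda>\<theta>. f \<theta> / (1 + t * f \<theta>) * cos (real n * \<theta>))"

definition j'' :: "nat \<Rightarrow> real \<Rightarrow> real" where
  "j'' n t = integral {0..pi} (\<lambda>\<theta>. - (f \<theta> / (1 + t * f \<theta>))\<^sup>2 * cos (real n * \<theta>))"

text \<open>The inhomogeneous constant of \<open>j_ode\<close>. Subtracting
  \<open>\<gamma> n / (real n / \<kappa>)\<^sup>2\<close> from \<open>j\<close> makes the equation
  homogeneous, and this shift disappears at the end, being orthogonal to the cosines.\<close>

definition \<gamma> :: "nat \<Rightarrow> real" where
  "\<gamma> n = integral {0..pi} (\<lambda>\<theta>. (f \<theta>)\<^sup>2 * cos (real n * \<theta>))"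

text \<open>Differentiation under the integral sign. The half-line \<open>{-1<..}\<close> is convex
  and open, so the derivative within it is the full derivative.\<close>

lemma j_has_derivative:
  assumes t: "-1 < t"
  shows "(j n has_real_derivative j' n t) (at t)"
proof -
  have ne: "1 + t * f \<theta> \<noteq> 0" "0 < 1 + t * f \<theta>" if "-1 < t" for t \<theta>
    using one_plus_f_pos[OF that, of \<theta>] by auto
  have "((\<lambda>t. integral (cbox 0 pi) (\<lambda>\<theta>. ln (1 + t * f \<theta>) * cos (real n * \<theta>))) has_real_derivative
      integral (cbox 0 pi) (\<lambda>\<theta>. f \<theta> / (1 + t * f \<theta>) * cos (real n * \<theta>))) (at t within {-1<..})"
  proof (rule leibniz_rule_field_derivative)
    show "continuous_on ({-1<..} \<times> cbox 0 pi)
        (\<lambda>(t, \<theta>). f \<theta> / (1 + t * f \<theta>) * cos (real n * \<theta>))"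
      by (auto intro!: continuous_intros simp: split_beta ne)
    show "((\<lambda>t. ln (1 + t * f \<theta>) * cos (real n * \<theta>)) has_real_derivative
        f \<theta> / (1 + t * f \<theta>) * cos (real n * \<theta>)) (at t within {-1<..})"
      if "t \<in> {-1<..}" for t \<theta>
      using that ne by (auto intro!: derivative_eq_intros)
    show "(\<lambda>\<theta>. ln (1 + t * f \<theta>) * cos (real n * \<theta>)) integrable_on cbox 0 pi"
      if "t \<in> {-1<..}" for t
      using that by (intro integrable_continuous continuous_intros) (auto simp: ne)
  qed (use t in auto)
  moreover have "at t within {-1<..} = at t"
    using t by (intro at_within_open) auto
  ultimately show ?thesis by (simp add: j_def[abs_def] j'_def)
qed

lemma j'_has_derivative:
  assumes t: "-1 < t"
  shows "(j' n has_real_derivative j'' n t) (at t)"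
proof -
  have ne: "1 + t * f \<theta> \<noteq> 0" if "-1 < t" for t \<theta>
    using one_plus_f_pos[OF that, of \<theta>] by auto
  have "((\<lambda>t. integral (cbox 0 pi) (\<lambda>\<theta>. f \<theta> / (1 + t * f \<theta>) * cos (real n * \<theta>))) has_real_derivative
      integral (cbox 0 pi) (\<lambda>\<theta>. - (f \<theta> / (1 + t * f \<theta>))\<^sup>2 * cos (real n * \<theta>))) (at t within {-1<..})"
  proof (rule leibniz_rule_field_derivative)
    show "continuous_on ({-1<..} \<times> cbox 0 pi)
        (\<lambda>(t, \<theta>). - (f \<theta> / (1 + t * f \<theta>))\<^sup>2 * cos (real n * \<theta>))"
      by (auto intro!: continuous_intros simp: split_beta ne)
    show "((\<lambda>t. f \<theta> / (1 + t * f \<theta>) * cos (real n * \<theta>)) has_real_derivative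
        - (f \<theta> / (1 + t * f \<theta>))\<^sup>2 * cos (real n * \<theta>)) (at t within {-1<..})"
      if "t \<in> {-1<..}" for t \<theta>
      using that ne[of t \<theta>]
      by (auto intro!: derivative_eq_intros simp: divide_simps power2_eq_square)
    show "(\<lambda>\<theta>. f \<theta> / (1 + t * f \<theta>) * cos (real n * \<theta>)) integrable_on cbox 0 pi"
      if "t \<in> {-1<..}" for t
      using that by (intro integrable_continuous continuous_intros) (auto simp: ne)
  qed (use t in auto)
  moreover have "at t within {-1<..} = at t"
    using t by (intro at_within_open) auto
  ultimately show ?thesis by (simp add: j'_def[abs_def] j''_def)
qed

text \<open>
  With \<open>L = ln (1 + t f \<theta>)\<close> this reads \<open>Q L\<^sub>t\<^sub>t + Q' L\<^sub>t / 2 = L\<^sub>\<theta>\<^sub>\<theta> / \<kappa>\<^sup>2 + f\<^sup>2 - r\<^sup>2 t\<^sup>2\<close> for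
  \<open>Q = (t\<^sup>2 - 1) (1 - r\<^sup>2 t\<^sup>2)\<close>.
\<close>

lemma log_f_partial_identity:
  fixes t \<theta> :: real
  defines "g \<equiv> 1 + t * f \<theta>"
  assumes "-1 < t"
  shows "(-1 + (1 + r\<^sup>2) * t\<^sup>2 - r\<^sup>2 * t ^ 4) * (- (f \<theta> / g)\<^sup>2)
      + ((1 + r\<^sup>2) * t - 2 * r\<^sup>2 * t ^ 3) * (f \<theta> / g)
    = (t * (\<kappa>\<^sup>2 * ((1 + r\<^sup>2) * f \<theta> - 2 * f \<theta> ^ 3)) / g - (t * f' \<theta> / g)\<^sup>2) / \<kappa>\<^sup>2
      + (f \<theta>)\<^sup>2 - r\<^sup>2 * t\<^sup>2"
proof -
  have g: "g \<noteq> 0" using one_plus_f_pos[OF assms(2), of \<theta>] by (simp add: g_def)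
  have "(t * (\<kappa>\<^sup>2 * ((1 + r\<^sup>2) * f \<theta> - 2 * f \<theta> ^ 3)) / g - (t * f' \<theta> / g)\<^sup>2) / \<kappa>\<^sup>2
    = t * ((1 + r\<^sup>2) * f \<theta> - 2 * f \<theta> ^ 3) / g
      - t\<^sup>2 * (- (f \<theta> ^ 4) + (1 + r\<^sup>2) * (f \<theta>)\<^sup>2 - r\<^sup>2) / g\<^sup>2"
    using \<kappa>_pos by (simp add: power_divide power_mult_distrib f'_squared diff_divide_distrib)
  moreover have "(-1 + (1 + r\<^sup>2) * t\<^sup>2 - r\<^sup>2 * t ^ 4) * (- (f \<theta> / g)\<^sup>2)
      + ((1 + r\<^sup>2) * t - 2 * r\<^sup>2 * t ^ 3) * (f \<theta> / g)
    = t * ((1 + r\<^sup>2) * f \<theta> - 2 * f \<theta> ^ 3) / g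
      - t\<^sup>2 * (- (f \<theta> ^ 4) + (1 + r\<^sup>2) * (f \<theta>)\<^sup>2 - r\<^sup>2) / g\<^sup>2
      + (f \<theta>)\<^sup>2 - r\<^sup>2 * t\<^sup>2"
    using g by (simp add: divide_simps) (simp add: g_def, algebra)
  ultimately show ?thesis by simp
qed

text \<open>Multiply the pointwise identity by \<open>cos (n * \<theta>)\<close> and integrate. Two
  integrations by parts turn the second derivative in \<open>\<theta>\<close> into a multiple of
  \<open>j\<close>, and the term free of \<open>\<theta>\<close> integrates to zero.\<close>

lemma j_ode:
  assumes t: "-1 < t" and n: "n \<ge> 1"
  shows "(-1 + (1 + r\<^sup>2) * t\<^sup>2 - r\<^sup>2 * t ^ 4) * j'' n t
      + ((1 + r\<^sup>2) * t - 2 * r\<^sup>2 * t ^ 3) * j' n t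
    = \<gamma> n - (real n / \<kappa>)\<^sup>2 * j n t"
proof -
  define g where "g \<theta> = 1 + t * f \<theta>" for \<theta>
  have g: "g \<theta> > 0" "g \<theta> \<noteq> 0" for \<theta>
    using one_plus_f_pos[OF t, of \<theta>] by (auto simp: g_def)
  have gc: "continuous_on A g" for A
    unfolding g_def by (intro continuous_intros)
  \<comment> \<open>\<open>L2\<close> is the second derivative of \<open>ln (g \<theta>)\<close> in
    \<open>\<theta>\<close>.\<close>
  define L2 where
    "L2 \<theta> = t * (\<kappa>\<^sup>2 * ((1 + r\<^sup>2) * f \<theta> - 2 * f \<theta> ^ 3)) / g \<theta> - (t * f' \<theta> / g \<theta>)\<^sup>2" for \<theta>
  note int = has_integral_integral[THEN iffD1, OF integrable_continuous_real]
  have J: "((\<lambda>\<theta>. ln (g \<theta>) * cos (real n * \<theta>)) has_integral j n t) {0..pi}"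
    unfolding j_def g_def[symmetric] using g by (intro int continuous_intros gc) auto
  have J1: "((\<lambda>\<theta>. f \<theta> / g \<theta> * cos (real n * \<theta>)) has_integral j' n t) {0..pi}"
    unfolding j'_def g_def[symmetric] using g by (intro int continuous_intros gc) auto
  have J2: "((\<lambda>\<theta>. - (f \<theta> / g \<theta>)\<^sup>2 * cos (real n * \<theta>)) has_integral j'' n t) {0..pi}"
    unfolding j''_def g_def[symmetric] using g by (intro int continuous_intros gc) auto
  have G: "((\<lambda>\<theta>. (f \<theta>)\<^sup>2 * cos (real n * \<theta>)) has_integral \<gamma> n) {0..pi}"
    unfolding \<gamma>_def by (intro int continuous_intros)
  have byparts: "((\<lambda>\<theta>. L2 \<theta> * cos (real n * \<theta>) + (real n)\<^sup>2 * (ln (g \<theta>) * cos (real n * \<theta>)))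
      has_integral 0) {0..pi}"
  proof -
    \<comment> \<open>\<open>B\<close> collects the boundary terms of both integrations by parts. It
      vanishes at 0 and \<open>pi\<close>, since \<open>f'\<close> and
      \<open>sin (n * \<theta>)\<close> do.\<close>
    define B where "B \<theta> = t * f' \<theta> / g \<theta> * cos (real n * \<theta>) + ln (g \<theta>) * (real n * sin (real n * \<theta>))" for \<theta>
    have gd: "(g has_real_derivative t * f' \<theta>) (at \<theta>)" for \<theta>
      unfolding g_def by (auto intro!: derivative_eq_intros f_has_derivative)
    have "(B has_real_derivative
        L2 \<theta> * cos (real n * \<theta>) + (real n)\<^sup>2 * (ln (g \<theta>) * cos (real n * \<theta>))) (at \<theta>)" for \<theta>
      unfolding B_def using g[of \<theta>]
      by (auto intro!: derivative_eq_intros f'_has_derivative gd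
          simp: L2_def field_simps power2_eq_square)
    then have "((\<lambda>\<theta>. L2 \<theta> * cos (real n * \<theta>) + (real n)\<^sup>2 * (ln (g \<theta>) * cos (real n * \<theta>)))
        has_integral B pi - B 0) {0..pi}"
      by (intro fundamental_theorem_of_calculus)
        (auto simp: has_real_derivative_iff_has_vector_derivative[symmetric] intro: has_field_derivative_at_within)
    then show ?thesis by (simp add: B_def f'_0 f'_pi)
  qed
  have "((\<lambda>\<theta>. (-1 + (1 + r\<^sup>2) * t\<^sup>2 - r\<^sup>2 * t ^ 4) * (- (f \<theta> / g \<theta>)\<^sup>2 * cos (real n * \<theta>))
      + ((1 + r\<^sup>2) * t - 2 * r\<^sup>2 * t ^ 3) * (f \<theta> / g \<theta> * cos (real n * \<theta>))) has_integral
      (-1 + (1 + r\<^sup>2) * t\<^sup>2 - r\<^sup>2 * t ^ 4) * j'' n t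
      + ((1 + r\<^sup>2) * t - 2 * r\<^sup>2 * t ^ 3) * j' n t) {0..pi}"
    by (intro has_integral_add has_integral_mult_right J1 J2)
  moreover have "(-1 + (1 + r\<^sup>2) * t\<^sup>2 - r\<^sup>2 * t ^ 4) * (- (f \<theta> / g \<theta>)\<^sup>2 * cos (real n * \<theta>))
      + ((1 + r\<^sup>2) * t - 2 * r\<^sup>2 * t ^ 3) * (f \<theta> / g \<theta> * cos (real n * \<theta>))
    = (L2 \<theta> * cos (real n * \<theta>) + (real n)\<^sup>2 * (ln (g \<theta>) * cos (real n * \<theta>))) / \<kappa>\<^sup>2
      + (f \<theta>)\<^sup>2 * cos (real n * \<theta>) - r\<^sup>2 * t\<^sup>2 * cos (real n * \<theta>)
      - (real n / \<kappa>)\<^sup>2 * (ln (g \<theta>) * cos (real n * \<theta>))" for \<theta>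
  proof -
    have "((-1 + (1 + r\<^sup>2) * t\<^sup>2 - r\<^sup>2 * t ^ 4) * (- (f \<theta> / g \<theta>)\<^sup>2)
      + ((1 + r\<^sup>2) * t - 2 * r\<^sup>2 * t ^ 3) * (f \<theta> / g \<theta>)) * cos (real n * \<theta>)
      = (L2 \<theta> / \<kappa>\<^sup>2 + (f \<theta>)\<^sup>2 - r\<^sup>2 * t\<^sup>2) * cos (real n * \<theta>)"
      unfolding g_def log_f_partial_identity[OF t] L2_def ..
    then show ?thesis by (simp add: algebra_simps add_divide_distrib power_divide)
  qed
  moreover have "((\<lambda>\<theta>. (L2 \<theta> * cos (real n * \<theta>) + (real n)\<^sup>2 * (ln (g \<theta>) * cos (real n * \<theta>))) / \<kappa>\<^sup>2
      + (f \<theta>)\<^sup>2 * cos (real n * \<theta>) - r\<^sup>2 * t\<^sup>2 * cos (real n * \<theta>)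
      - (real n / \<kappa>)\<^sup>2 * (ln (g \<theta>) * cos (real n * \<theta>))) has_integral
      0 / \<kappa>\<^sup>2 + \<gamma> n - r\<^sup>2 * t\<^sup>2 * 0 - (real n / \<kappa>)\<^sup>2 * j n t) {0..pi}"
    by (intro has_integral_add has_integral_diff has_integral_mult_right has_integral_divide
        byparts G J integral_cos_nat_0_pi n)
  ultimately show ?thesis
    by (auto dest: has_integral_unique)
qed

section \<open>Two substitutions that make the coefficients constant\<close>

text \<open>Let Q(t) = (t^2 - 1) (1 - r^2 t^2). The function \<open>t = 1 / f \<phi>\<close>
  satisfies t'^2 = \<kappa>^2 Q(t) and t'' = \<kappa>^2 Q'(t) / 2, so \<open>j_ode\<close> becomes
  V'' = - n^2 V. Since \<open>f' 0 = 0\<close>, the sine part is absent, and \<open>f 0 = 1\<close>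
  gives the amplitude.\<close>

lemma j_reciprocal_f:
  assumes n: "n \<ge> 1"
  shows "j n (1 / f \<phi>) - \<gamma> n / (real n / \<kappa>)\<^sup>2
    = (j n 1 - \<gamma> n / (real n / \<kappa>)\<^sup>2) * cos (real n * \<phi>)"
proof -
  define V where "V \<phi> = j n (1 / f \<phi>) - \<gamma> n / (real n / \<kappa>)\<^sup>2" for \<phi>
  define V' where "V' \<phi> = j' n (1 / f \<phi>) * (- f' \<phi> / (f \<phi>)\<^sup>2)" for \<phi>
  have f0: "f \<phi> \<noteq> 0" "f \<phi> > 0" and inv: "-1 < 1 / f \<phi>" for \<phi>
    using f_pos[of \<phi>] by (auto intro: less_trans[of _ 0])
  have d: "((\<lambda>\<phi>. 1 / f \<phi>) has_real_derivative - f' \<phi> / (f \<phi>)\<^sup>2) (at \<phi>)" for \<phi>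
    using f0 by (auto intro!: derivative_eq_intros f_has_derivative simp: power2_eq_square)
  have V: "(V has_real_derivative V' \<phi>) (at \<phi>)" for \<phi>
    unfolding V_def V'_def
    by (rule DERIV_cong[OF DERIV_diff[OF DERIV_chain2[OF j_has_derivative[OF inv] d] DERIV_const]]) simp
  have V': "(V' has_real_derivative - (real n)\<^sup>2 * V \<phi>) (at \<phi>)" for \<phi>
  proof -
    let ?f'' = "\<kappa>\<^sup>2 * ((1 + r\<^sup>2) * f \<phi> - 2 * f \<phi> ^ 3)" and ?t = "1 / f \<phi>"
    have d2: "((\<lambda>\<phi>. - f' \<phi> / (f \<phi>)\<^sup>2) has_real_derivative
        - ?f'' / (f \<phi>)\<^sup>2 + 2 * (f' \<phi>)\<^sup>2 / (f \<phi>) ^ 3) (at \<phi>)"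
      by (rule derivative_eq_intros f'_has_derivative f_has_derivative refl | simp add: f0)+
        (use f0 in \<open>simp add: divide_simps; simp add: algebra_simps eval_nat_numeral\<close>)
    have "(- f' \<phi> / (f \<phi>)\<^sup>2)\<^sup>2 = \<kappa>\<^sup>2 * (-1 + (1 + r\<^sup>2) * ?t\<^sup>2 - r\<^sup>2 * ?t ^ 4)"
      unfolding power_divide power2_minus f'_squared using f0[of \<phi>]
      by (simp add: divide_simps power2_eq_square power4_eq_xxxx) (simp add: algebra_simps)
    moreover have "- ?f'' / (f \<phi>)\<^sup>2 + 2 * (f' \<phi>)\<^sup>2 / (f \<phi>) ^ 3
        = \<kappa>\<^sup>2 * ((1 + r\<^sup>2) * ?t - 2 * r\<^sup>2 * ?t ^ 3)"
      unfolding f'_squared using f0[of \<phi>]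
      by (simp add: divide_simps) (simp add: algebra_simps eval_nat_numeral)
    ultimately have "j'' n ?t * (- f' \<phi> / (f \<phi>)\<^sup>2) * (- f' \<phi> / (f \<phi>)\<^sup>2)
        + (- ?f'' / (f \<phi>)\<^sup>2 + 2 * (f' \<phi>)\<^sup>2 / (f \<phi>) ^ 3) * j' n ?t
      = \<kappa>\<^sup>2 * ((-1 + (1 + r\<^sup>2) * ?t\<^sup>2 - r\<^sup>2 * ?t ^ 4) * j'' n ?t
         + ((1 + r\<^sup>2) * ?t - 2 * r\<^sup>2 * ?t ^ 3) * j' n ?t)"
      by (simp only: mult.assoc power2_eq_square[symmetric]) (simp add: algebra_simps)
    also have "\<dots> = - (real n)\<^sup>2 * V \<phi>"
      unfolding j_ode[OF inv n] using \<kappa>_pos n by (simp add: V_def field_simps)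
    finally show ?thesis
      unfolding V'_def
      using DERIV_mult[OF DERIV_chain2[OF j'_has_derivative[OF inv] d] d2, of n]
      by (simp only: mult.assoc)
  qed
  \<comment> \<open>Rotating the vector (n V, V') by the angle \<open>n * \<phi>\<close> gives two
    constants of motion \<open>p\<close> and \<open>s\<close>. Rotating back recovers
    \<open>V\<close> without a uniqueness theorem.\<close>
  define p where "p \<phi> = real n * V \<phi> * cos (real n * \<phi>) - V' \<phi> * sin (real n * \<phi>)" for \<phi>
  define s where "s \<phi> = real n * V \<phi> * sin (real n * \<phi>) + V' \<phi> * cos (real n * \<phi>)" for \<phi>
  have "(p has_real_derivative 0) (at \<phi>)" for \<phi>
    unfolding p_def
    by (auto intro!: derivative_eq_intros V V' simp: algebra_simps power2_eq_square)
  then have "p \<phi> = p 0"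
    using DERIV_isconst_all by blast
  moreover have "(s has_real_derivative 0) (at \<phi>)" for \<phi>
    unfolding s_def
    by (auto intro!: derivative_eq_intros V V' simp: algebra_simps power2_eq_square)
  then have "s \<phi> = s 0"
    using DERIV_isconst_all by blast
  moreover have "p 0 = real n * V 0" "s 0 = 0" by (simp_all add: p_def s_def V'_def f'_0)
  moreover have "p \<phi> * cos (real n * \<phi>) + s \<phi> * sin (real n * \<phi>)
      = real n * V \<phi> * ((sin (real n * \<phi>))\<^sup>2 + (cos (real n * \<phi>))\<^sup>2)"
    unfolding p_def s_def by algebra
  ultimately have "real n * V \<phi> = real n * (V 0 * cos (real n * \<phi>))" by auto
  then have "V \<phi> = V 0 * cos (real n * \<phi>)" using n by simp
  then show ?thesis by (simp add: V_def f_0)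
qed

text \<open>Put \<open>t = sin x\<close> and \<open>w = elliptic_F x r\<close>. Then (dt/dw)^2 = (1
  - t^2) (1 - r^2 t^2), the negative of the leading coefficient of \<open>j_ode\<close>, so U'' =
  \<nu>^2 U in \<open>w\<close>. The left side is dU/dw; it vanishes at \<open>x = pi / 2\<close>,
  that is at \<open>w = K(r)\<close>, because of the factor \<open>cos x\<close>.\<close>

lemma j_sin:
  assumes n: "n \<ge> 1" and x: "-pi / 2 < x" "x \<le> pi / 2"
  shows "sqrt (1 - r\<^sup>2 * (sin x)\<^sup>2) * cos x * j' n (sin x)
    = real n / \<kappa> * (j n 1 - \<gamma> n / (real n / \<kappa>)\<^sup>2) * sinh (real n / \<kappa> * (elliptic_F x r - elliptic_K r))"
proof -
  define \<nu> where "\<nu> = real n / \<kappa>"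
  define \<Delta> where "\<Delta> x = sqrt (1 - r\<^sup>2 * (sin x)\<^sup>2)" for x
  define U where "U x = j n (sin x) - \<gamma> n / \<nu>\<^sup>2" for x
  define W where "W x = \<Delta> x * cos x * j' n (sin x)" for x
  let ?F = "\<lambda>x. elliptic_F x r"
  \<comment> \<open>The interval is symmetric about \<open>pi / 2\<close>, which thereby becomes an
    interior point with two-sided derivatives, and \<open>sin x > -1\<close> holds
    throughout.\<close>
  let ?I = "{-pi/2<..<3*pi/2}"
  have \<nu>: "\<nu> > 0" using n \<kappa>_pos by (simp add: \<nu>_def)
  have \<Delta>2: "(\<Delta> x)\<^sup>2 = 1 - r\<^sup>2 * (sin x)\<^sup>2" and \<Delta>0: "\<Delta> x > 0" for x
    using elliptic_radicand_pos[OF r2_less_1, of x] by (auto simp: \<Delta>_def)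
  have sin: "-1 < sin x" if "x \<in> ?I" for x
  proof -
    have "0 < cos ((x - pi / 2) / 2)"
      using that by (intro cos_gt_zero_pi) auto
    then have "-1 < 2 * (cos ((x - pi / 2) / 2))\<^sup>2 - 1" by simp
    also have "\<dots> = cos (x - pi / 2)"
      using cos_double_cos[of "(x - pi / 2) / 2"] by (simp only: field_sum_of_halves mult_2)
    finally show ?thesis by (simp add: cos_diff)
  qed
  have F: "(?F has_real_derivative 1 / \<Delta> x) (at x)" for x
    unfolding \<Delta>_def by (rule elliptic_F_has_derivative[OF r2_less_1])
  have \<Delta>d: "(\<Delta> has_real_derivative - r\<^sup>2 * sin x * cos x / \<Delta> x) (at x)" for x
    unfolding \<Delta>_def using elliptic_radicand_pos[OF r2_less_1, of x]
    by (auto intro!: derivative_eq_intros simp: divide_simps)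
  have Ud: "(U has_real_derivative W x / \<Delta> x) (at x)" if "x \<in> ?I" for x
  proof -
    have "(U has_real_derivative j' n (sin x) * cos x - 0) (at x)"
      unfolding U_def
      by (intro DERIV_diff DERIV_const DERIV_chain2[where f = "j n"] j_has_derivative sin that DERIV_sin)
    then show ?thesis using \<Delta>0[of x] by (simp add: W_def mult.commute)
  qed
  have Wd: "(W has_real_derivative \<nu>\<^sup>2 * U x / \<Delta> x) (at x)" if "x \<in> ?I" for x
  proof -
    let ?t = "sin x"
    have jd: "((\<lambda>x. j' n (sin x)) has_real_derivative j'' n (sin x) * cos x) (at x)"
      by (intro DERIV_chain2[where f = "j' n"] j'_has_derivative sin that DERIV_sin)
    have "(W has_real_derivative
        (- r\<^sup>2 * sin x * cos x / \<Delta> x * cos x - \<Delta> x * sin x) * j' n (sin x)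
         + \<Delta> x * cos x * (j'' n (sin x) * cos x)) (at x)"
      unfolding W_def
      by (rule derivative_eq_intros \<Delta>d jd refl)+ (simp add: algebra_simps)
    also have "(- r\<^sup>2 * sin x * cos x / \<Delta> x * cos x - \<Delta> x * sin x) * j' n (sin x)
         + \<Delta> x * cos x * (j'' n (sin x) * cos x)
       = ((- r\<^sup>2 * sin x * (cos x)\<^sup>2 - (\<Delta> x)\<^sup>2 * sin x) * j' n (sin x)
         + (\<Delta> x)\<^sup>2 * (cos x)\<^sup>2 * j'' n (sin x)) / \<Delta> x"
      using \<Delta>0[of x] by (simp add: field_simps power2_eq_square)
    also have "(- r\<^sup>2 * sin x * (cos x)\<^sup>2 - (\<Delta> x)\<^sup>2 * sin x) * j' n (sin x)
         + (\<Delta> x)\<^sup>2 * (cos x)\<^sup>2 * j'' n (sin x)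
       = - ((-1 + (1 + r\<^sup>2) * ?t\<^sup>2 - r\<^sup>2 * ?t ^ 4) * j'' n ?t
          + ((1 + r\<^sup>2) * ?t - 2 * r\<^sup>2 * ?t ^ 3) * j' n ?t)"
      unfolding \<Delta>2 cos_squared_eq
      by (simp add: algebra_simps power2_eq_square power3_eq_cube power4_eq_xxxx)
    also have "\<dots> = \<nu>\<^sup>2 * U x"
      unfolding j_ode[OF sin[OF that] n] U_def \<nu>_def[symmetric] using \<nu> by (simp add: algebra_simps)
    finally show ?thesis .
  qed
  \<comment> \<open>With W = dU/dw, the combination W + c U satisfies y' = c y whenever c^2 =
    \<nu>^2. Taking c = \<nu> and c = - \<nu> and adding the results isolates
    \<open>W\<close>.\<close>
  have const: "exp (- c * ?F x) * (W x + c * U x) = exp (- c * ?F (pi / 2)) * (W (pi / 2) + c * U (pi / 2))"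
    if c: "c\<^sup>2 = \<nu>\<^sup>2" for c
  proof (rule DERIV_isconst3[where a = "-pi/2" and b = "3*pi/2"
        and f = "\<lambda>x. exp (- c * ?F x) * (W x + c * U x)"])
    fix x assume I: "x \<in> ?I"
    have "((\<lambda>x. exp (- c * ?F x) * (W x + c * U x)) has_real_derivative
       exp (- c * ?F x) * (- c * (1 / \<Delta> x)) * (W x + c * U x)
       + (\<nu>\<^sup>2 * U x / \<Delta> x + c * (W x / \<Delta> x)) * exp (- c * ?F x)) (at x)"
      by (intro DERIV_mult DERIV_add DERIV_cmult DERIV_fun_exp F Ud[OF I] Wd[OF I])
    also have "exp (- c * ?F x) * (- c * (1 / \<Delta> x)) * (W x + c * U x)
       + (\<nu>\<^sup>2 * U x / \<Delta> x + c * (W x / \<Delta> x)) * exp (- c * ?F x) = 0"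
      unfolding c[symmetric] using \<Delta>0[of x] by (simp add: field_simps power2_eq_square)
    finally show "((\<lambda>x. exp (- c * ?F x) * (W x + c * U x)) has_real_derivative 0) (at x)" .
  qed (use x in auto)
  have W0: "W (pi / 2) = 0" by (simp add: W_def)
  let ?d = "\<nu> * (?F x - elliptic_K r)"
  have e1: "W x + \<nu> * U x = exp ?d * (\<nu> * U (pi / 2))"
    using const[of \<nu>] by (simp add: W0 elliptic_K_def exp_minus exp_diff right_diff_distrib field_simps)
  have e2: "W x - \<nu> * U x = - exp (- ?d) * (\<nu> * U (pi / 2))"
    using const[of "- \<nu>"] by (simp add: W0 elliptic_K_def exp_minus exp_diff right_diff_distrib field_simps)
  have "W x = \<nu> * U (pi / 2) * sinh ?d"
    using e1 e2 by (simp add: sinh_def field_simps)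
  then show ?thesis by (simp add: W_def U_def \<Delta>_def \<nu>_def)
qed

section \<open>Behaviour as \<open>t\<close> tends to -1\<close>

text \<open>Since \<open>f\<close> is at least \<open>r\<close>, the amplitude grows at least like
  \<open>\<kappa> * r * \<theta>\<close>, and Jordan's inequality passes from the amplitude to its
  sine. This lets \<open>1 - cos (n * \<theta>)\<close> be compared with the square of sn.\<close>

lemma theta_le_sin_\<alpha>:
  assumes "0 \<le> \<theta>" "\<theta> \<le> pi"
  shows "\<theta> \<le> pi / (2 * \<kappa> * r) * sin (\<alpha> \<theta>)"
proof -
  have *: "\<exists>y. ((\<lambda>\<theta>. \<alpha> \<theta> - \<kappa> * r * \<theta>) has_real_derivative y) (at z) \<and> 0 \<le> y" for z
  proof (intro exI conjI)
    show "((\<lambda>\<theta>. \<alpha> \<theta> - \<kappa> * r * \<theta>) has_real_derivative \<kappa> * f z - \<kappa> * r) (at z)"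
      by (auto intro!: derivative_eq_intros \<alpha>_has_derivative)
    show "0 \<le> \<kappa> * f z - \<kappa> * r"
      using f_ge_r[of z] \<kappa>_pos by simp
  qed
  have "\<alpha> 0 - \<kappa> * r * 0 \<le> \<alpha> \<theta> - \<kappa> * r * \<theta>"
    by (rule DERIV_nonneg_imp_nondecreasing) (use assms * in auto)
  then have 1: "\<kappa> * r * \<theta> \<le> \<alpha> \<theta>" by (simp add: \<alpha>_0)
  have "\<alpha> \<theta> \<le> \<alpha> pi"
    by (rule DERIV_nonneg_imp_nondecreasing)
      (use assms \<alpha>_has_derivative \<kappa>_pos f_pos in \<open>auto intro!: exI mult_nonneg_nonneg less_imp_le\<close>)
  moreover have "0 \<le> \<kappa> * r * \<theta>" using \<kappa>_pos r_pos assms by simp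
  ultimately have "2 / pi * \<alpha> \<theta> \<le> sin (\<alpha> \<theta>)"
    using 1 by (intro sin_ge_two_pi_mult) (auto simp: \<alpha>_pi)
  then have "\<alpha> \<theta> \<le> pi / 2 * sin (\<alpha> \<theta>)" by (simp add: field_simps)
  with 1 have "\<kappa> * r * \<theta> \<le> pi / 2 * sin (\<alpha> \<theta>)" by linarith
  then show ?thesis using \<kappa>_pos r_pos by (simp add: field_simps)
qed

text \<open>Puts the denominator of the kernel into the form A cos^2 + B sin^2, for which the
  arctangent antiderivative is available.\<close>

lemma one_minus_tf_squared:
  "1 - t\<^sup>2 * (f \<theta>)\<^sup>2 = (1 - t\<^sup>2) * (cos (\<alpha> \<theta>))\<^sup>2 + (1 - r\<^sup>2 * t\<^sup>2) * (sin (\<alpha> \<theta>))\<^sup>2"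
  unfolding f_squared cos_squared_eq r2_eq by (simp add: algebra_simps)

lemma abs_less_1_radicands:
  fixes t :: real
  assumes "\<bar>t\<bar> < 1"
  shows "0 < 1 - t\<^sup>2" "0 < 1 - r\<^sup>2 * t\<^sup>2"
proof -
  show *: "0 < 1 - t\<^sup>2" using assms by (simp add: abs_square_less_1)
  have "r\<^sup>2 * t\<^sup>2 \<le> 1 * t\<^sup>2" using r2_less_1 by (intro mult_right_mono) auto
  then show "0 < 1 - r\<^sup>2 * t\<^sup>2" using * by simp
qed

text \<open>Substituting the amplitude, with d\<alpha> = \<kappa> f d\<theta>, reduces this to an
  elementary integral over \<open>{0..pi / 2}\<close>. The normalising root makes the mass
  independent of \<open>t\<close>.\<close>

lemma f_kernel_integral:
  assumes "\<bar>t\<bar> < 1"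
  shows "((\<lambda>\<theta>. sqrt ((1 - t\<^sup>2) * (1 - r\<^sup>2 * t\<^sup>2)) * f \<theta> / (1 - t\<^sup>2 * (f \<theta>)\<^sup>2))
    has_integral pi / (2 * \<kappa>)) {0..pi}"
proof -
  let ?A = "1 - t\<^sup>2" and ?B = "1 - r\<^sup>2 * t\<^sup>2"
  note AB = abs_less_1_radicands[OF assms]
  \<comment> \<open>This \<open>a\<close> makes A (cos^2 + a^2 sin^2) equal to A cos^2 + B sin^2,
    and \<open>a * ?A\<close> is then the normalising root.\<close>
  define a where "a = sqrt (?B / ?A)"
  have a: "a > 0" using AB by (simp add: a_def)
  have a2: "a\<^sup>2 = ?B / ?A" using AB by (simp add: a_def)
  have aA: "a * ?A = sqrt (?A * ?B)"
  proof (rule power2_eq_imp_eq)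
    show "(a * ?A)\<^sup>2 = (sqrt (?A * ?B))\<^sup>2"
      using AB unfolding power_mult_distrib a2 by (simp add: power2_eq_square)
  qed (use a AB in auto)
  define P where "P x = x + arctan ((a - 1) * sin x * cos x / ((cos x)\<^sup>2 + a * (sin x)\<^sup>2))" for x
  have "((\<lambda>\<theta>. 1 / \<kappa> * P (\<alpha> \<theta>)) has_real_derivative
      sqrt (?A * ?B) * f \<theta> / (1 - t\<^sup>2 * (f \<theta>)\<^sup>2)) (at \<theta>)" for \<theta>
  proof -
    have "((\<lambda>\<theta>. 1 / \<kappa> * P (\<alpha> \<theta>)) has_real_derivative
      1 / \<kappa> * (a / ((cos (\<alpha> \<theta>))\<^sup>2 + a\<^sup>2 * (sin (\<alpha> \<theta>))\<^sup>2) * (\<kappa> * f \<theta>))) (at \<theta>)"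
      unfolding P_def
      by (intro DERIV_cmult DERIV_chain2[OF arctan_scaled_tan_has_derivative[OF a] \<alpha>_has_derivative])
    also have "(cos (\<alpha> \<theta>))\<^sup>2 + a\<^sup>2 * (sin (\<alpha> \<theta>))\<^sup>2 = (1 - t\<^sup>2 * (f \<theta>)\<^sup>2) / ?A"
      unfolding a2 one_minus_tf_squared using AB by (simp add: field_simps)
    also have "1 / \<kappa> * (a / ((1 - t\<^sup>2 * (f \<theta>)\<^sup>2) / ?A) * (\<kappa> * f \<theta>))
        = a * ?A * f \<theta> / (1 - t\<^sup>2 * (f \<theta>)\<^sup>2)"
      using \<kappa>_pos by simp
    finally show ?thesis by (simp only: aA)
  qed
  then have "((\<lambda>\<theta>. sqrt (?A * ?B) * f \<theta> / (1 - t\<^sup>2 * (f \<theta>)\<^sup>2))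
      has_integral 1 / \<kappa> * P (\<alpha> pi) - 1 / \<kappa> * P (\<alpha> 0)) {0..pi}"
    by (intro fundamental_theorem_of_calculus)
      (auto simp: has_real_derivative_iff_has_vector_derivative[symmetric] intro: has_field_derivative_at_within)
  then show ?thesis by (simp add: P_def \<alpha>_0 \<alpha>_pi mult.commute)
qed

text \<open>
  The kernel has mass \<open>pi / (2 \<kappa>)\<close> by \<open>f_kernel_integral\<close>, and the factor that multiplies it differs from
  its value at \<open>\<theta> = 0\<close> by at most a constant times \<open>(sin (\<alpha> \<theta>))\<^sup>2\<close>, which cancels the singularity.
\<close>

lemma j'_asymptotic:
  "\<exists>C. \<forall>t\<in>{-1<..<0}.
    \<bar>sqrt ((1 - t\<^sup>2) * (1 - r\<^sup>2 * t\<^sup>2)) * j' n t - (1 - t) * (pi / (2 * \<kappa>))\<bar>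
      \<le> sqrt ((1 - t\<^sup>2) * (1 - r\<^sup>2 * t\<^sup>2)) / t\<^sup>2 * C"
proof -
  \<comment> \<open>The first summand comes from 1 - cos y \<le> y^2 / 2 together with
    \<open>theta_le_sin_\<alpha>\<close>, the second from 1 - f \<le> k^2 sn^2.\<close>
  define c where "c = (real n)\<^sup>2 * (pi / (2 * \<kappa> * r))\<^sup>2 + k\<^sup>2"
  have c: "c \<ge> 0" by (simp add: c_def)
  have k: "k\<^sup>2 > 0" using r2_less_1 by (simp add: k2_eq)
  have main: "\<bar>sqrt ((1 - t\<^sup>2) * (1 - r\<^sup>2 * t\<^sup>2)) * j' n t - (1 - t) * (pi / (2 * \<kappa>))\<bar>
      \<le> sqrt ((1 - t\<^sup>2) * (1 - r\<^sup>2 * t\<^sup>2)) / t\<^sup>2 * (c / k\<^sup>2 * pi)" if t: "-1 < t" "t < 0" for t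
  proof -
    define R where "R = sqrt ((1 - t\<^sup>2) * (1 - r\<^sup>2 * t\<^sup>2))"
    have t1: "\<bar>t\<bar> < 1" using t by simp
    note AB = abs_less_1_radicands[OF t1]
    have R: "R > 0" using AB by (simp add: R_def)
    \<comment> \<open>Over the common denominator (1 + t f) (1 - t f) the difference of the two
      integrands has numerator \<open>R * f \<theta> * h \<theta>\<close>, and
      \<open>h 0 = 0\<close>.\<close>
    define h where "h \<theta> = (1 - t * f \<theta>) * cos (real n * \<theta>) - (1 - t)" for \<theta>
    have tf: "0 < 1 + t * f \<theta>" for \<theta> by (rule one_plus_f_pos[OF t(1)])
    have tf': "0 < 1 - t * f \<theta>" "1 - t * f \<theta> \<le> 2" for \<theta>
    proof -
      have "- t * f \<theta> \<le> 1 * 1" using t f_le_1[of \<theta>] f_pos[of \<theta>] by (intro mult_mono) auto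
      then show "1 - t * f \<theta> \<le> 2" by simp
      have "0 < - t * f \<theta>" using t f_pos[of \<theta>] by (intro mult_pos_pos) auto
      then show "0 < 1 - t * f \<theta>" by simp
    qed
    have den: "1 - t\<^sup>2 * (f \<theta>)\<^sup>2 = (1 + t * f \<theta>) * (1 - t * f \<theta>)" for \<theta>
      by (simp add: algebra_simps power2_eq_square)
    have J: "((\<lambda>\<theta>. R * (f \<theta> / (1 + t * f \<theta>) * cos (real n * \<theta>))) has_integral R * j' n t) {0..pi}"
      unfolding j'_def using tf
      by (intro has_integral_mult_right integrable_integral integrable_continuous_real continuous_intros)
        (auto simp: less_imp_neq[symmetric])
    have "((\<lambda>\<theta>. R * (f \<theta> / (1 + t * f \<theta>) * cos (real n * \<theta>))
        - (1 - t) * (R * f \<theta> / (1 - t\<^sup>2 * (f \<theta>)\<^sup>2))) has_integral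
        R * j' n t - (1 - t) * (pi / (2 * \<kappa>))) {0..pi}"
      using f_kernel_integral[OF t1] by (intro has_integral_diff J has_integral_mult_right) (simp add: R_def)
    moreover have "norm (R * (f \<theta> / (1 + t * f \<theta>) * cos (real n * \<theta>))
        - (1 - t) * (R * f \<theta> / (1 - t\<^sup>2 * (f \<theta>)\<^sup>2))) \<le> R / t\<^sup>2 * (c / k\<^sup>2)"
      if \<theta>: "\<theta> \<in> {0..pi}" for \<theta>
    proof -
      let ?S = "(sin (\<alpha> \<theta>))\<^sup>2"
      have eq: "R * (f \<theta> / (1 + t * f \<theta>) * cos (real n * \<theta>))
        - (1 - t) * (R * f \<theta> / (1 - t\<^sup>2 * (f \<theta>)\<^sup>2)) = R * f \<theta> * h \<theta> / (1 - t\<^sup>2 * (f \<theta>)\<^sup>2)"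
        unfolding den h_def using tf[of \<theta>] tf'(1)[of \<theta>] by (simp add: divide_simps) (simp add: algebra_simps)
      have "\<theta>\<^sup>2 \<le> (pi / (2 * \<kappa> * r) * sin (\<alpha> \<theta>))\<^sup>2"
        using \<theta> theta_le_sin_\<alpha>[of \<theta>] by (intro power_mono) auto
      then have \<theta>S: "\<theta>\<^sup>2 \<le> (pi / (2 * \<kappa> * r))\<^sup>2 * ?S"
        by (simp only: power_mult_distrib)
      have "1 - cos (real n * \<theta>) \<le> (real n * \<theta>)\<^sup>2 / 2"
      proof -
        have "1 - cos (real n * \<theta>) = 2 * (sin (real n * \<theta> / 2))\<^sup>2"
          using cos_double_sin[of "real n * \<theta> / 2"] by simp
        also have "(sin (real n * \<theta> / 2))\<^sup>2 \<le> (real n * \<theta> / 2)\<^sup>2"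
          using abs_sin_x_le_abs_x[of "real n * \<theta> / 2"] by (simp only: abs_le_square_iff)
        finally show ?thesis by (simp add: power_divide)
      qed
      then have "(1 - t * f \<theta>) * (1 - cos (real n * \<theta>)) \<le> 2 * ((real n * \<theta>)\<^sup>2 / 2)"
        using tf'[of \<theta>] by (intro mult_mono) auto
      then have h1: "(1 - t * f \<theta>) * (1 - cos (real n * \<theta>)) \<le> (real n)\<^sup>2 * \<theta>\<^sup>2"
        by (simp add: power_mult_distrib)
      have "(- t) * (1 - f \<theta>) \<le> 1 * (1 - f \<theta>)"
        using t f_le_1[of \<theta>] by (intro mult_right_mono) auto
      \<comment> \<open>From f^2 \<le> f follows 1 - f \<le> 1 - f^2 = k^2 sn^2.\<close>
      also have "f \<theta> * f \<theta> \<le> f \<theta> * 1"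
        using f_pos[of \<theta>] f_le_1[of \<theta>] by (intro mult_left_mono) auto
      then have "1 * (1 - f \<theta>) \<le> k\<^sup>2 * ?S"
        using f_squared[of \<theta>] by (simp add: power2_eq_square)
      finally have h2: "(- t) * (1 - f \<theta>) \<le> k\<^sup>2 * ?S" .
      have "h \<theta> = - ((1 - t * f \<theta>) * (1 - cos (real n * \<theta>))) - (- t) * (1 - f \<theta>)"
        by (simp add: h_def algebra_simps)
      moreover have "0 \<le> (1 - t * f \<theta>) * (1 - cos (real n * \<theta>))"
        using tf'(1)[of \<theta>] by (intro mult_nonneg_nonneg) auto
      moreover have "0 \<le> (- t) * (1 - f \<theta>)" using t f_le_1[of \<theta>] by (intro mult_nonneg_nonneg) auto
      ultimately have "\<bar>h \<theta>\<bar> \<le> (real n)\<^sup>2 * \<theta>\<^sup>2 + k\<^sup>2 * ?S"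
        using h1 h2 by linarith
      also have "\<dots> \<le> (real n)\<^sup>2 * ((pi / (2 * \<kappa> * r))\<^sup>2 * ?S) + k\<^sup>2 * ?S"
        using \<theta>S by (intro add_mono mult_left_mono) auto
      finally have h: "\<bar>h \<theta>\<bar> \<le> c * ?S" by (simp add: c_def algebra_simps)
      \<comment> \<open>The denominator is 1 - t^2 + t^2 k^2 sn^2, so it dominates the sn^2 in the
        bound for \<open>h\<close>. Dividing by t^2 k^2 explains the shape of the final
        constant.\<close>
      have S: "?S * (t\<^sup>2 * k\<^sup>2) \<le> 1 - t\<^sup>2 * (f \<theta>)\<^sup>2"
        unfolding f_squared using AB(1) by (simp add: algebra_simps)
      have pos: "0 < 1 - t\<^sup>2 * (f \<theta>)\<^sup>2"
        unfolding den using tf[of \<theta>] tf'(1)[of \<theta>] by simp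
      have "\<bar>R * f \<theta> * h \<theta>\<bar> \<le> R * 1 * (c * ?S)"
        unfolding abs_mult using R f_pos[of \<theta>] f_le_1[of \<theta>] h c
        by (intro mult_mono) auto
      then have "\<bar>R * f \<theta> * h \<theta>\<bar> * (t\<^sup>2 * k\<^sup>2) \<le> R * 1 * (c * ?S) * (t\<^sup>2 * k\<^sup>2)"
        by (intro mult_right_mono) auto
      also have "\<dots> = R * c * (?S * (t\<^sup>2 * k\<^sup>2))" by simp
      also have "\<dots> \<le> R * c * (1 - t\<^sup>2 * (f \<theta>)\<^sup>2)"
        using S R c by (intro mult_left_mono) auto
      finally have "\<bar>R * f \<theta> * h \<theta>\<bar> / (1 - t\<^sup>2 * (f \<theta>)\<^sup>2) \<le> R * c / (t\<^sup>2 * k\<^sup>2)"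
        using pos k t by (simp add: divide_simps)
      then show ?thesis unfolding eq using pos by (simp add: abs_divide)
    qed
    ultimately have "norm (R * j' n t - (1 - t) * (pi / (2 * \<kappa>))) \<le> R / t\<^sup>2 * (c / k\<^sup>2) * measure lborel {0..pi}"
      using R c by (intro has_integral_bound_real[of _ "{}"]) auto
    then show ?thesis by (simp add: R_def)
  qed
  then show ?thesis by (intro exI[of _ "c / k\<^sup>2 * pi"] ballI) (simp only: greaterThanLessThan_iff)
qed

text \<open>The limit of \<open>W\<close> at \<open>- pi / 2\<close> is computed twice.
  \<open>j_sin\<close> gives \<open>\<nu> * U\<close> times the hyperbolic sine of
  \<open>- 2 * \<nu> * K(r)\<close>; \<open>j'_asymptotic\<close> gives the kernel mass
  \<open>pi / (2 * \<kappa>)\<close> times the limit 2 of \<open>1 - t\<close>.\<close>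

lemma j_1:
  assumes n: "n \<ge> 1"
  shows "real n * (j n 1 - \<gamma> n / (real n / \<kappa>)\<^sup>2) * sinh (2 * (real n / \<kappa>) * elliptic_K r) = - pi"
proof -
  define \<nu> where "\<nu> = real n / \<kappa>"
  define U where "U = j n 1 - \<gamma> n / \<nu>\<^sup>2"
  define W where "W x = sqrt (1 - r\<^sup>2 * (sin x)\<^sup>2) * cos x * j' n (sin x)" for x
  let ?F = "at_right (-pi / 2)"
  have near: "eventually (\<lambda>x. x \<in> {-pi / 2<..<0}) ?F"
    by (rule eventually_at_right_real) simp
  \<comment> \<open>The closed form is continuous up to \<open>- pi / 2\<close>, although
    \<open>j'\<close> is under control only for \<open>sin x > -1\<close>.\<close>
  have "((\<lambda>x. \<nu> * U * sinh (\<nu> * (elliptic_F x r - elliptic_K r))) \<longlongrightarrow>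
      \<nu> * U * sinh (\<nu> * (elliptic_F (-pi / 2) r - elliptic_K r))) ?F"
    by (intro tendsto_intros tendsto_sinh tendsto_mono[OF at_le isContD[OF isCont_elliptic_F[OF r2_less_1]]] subset_UNIV)
  moreover have "eventually (\<lambda>x. \<nu> * U * sinh (\<nu> * (elliptic_F x r - elliptic_K r)) = W x) ?F"
    using near by eventually_elim (use j_sin[OF n] in \<open>simp add: \<nu>_def U_def W_def\<close>)
  ultimately have 1: "(W \<longlongrightarrow> \<nu> * U * sinh (\<nu> * (elliptic_F (-pi / 2) r - elliptic_K r))) ?F"
    by (rule Lim_transform_eventually)
  obtain C where C: "\<forall>t\<in>{-1<..<0}.
    \<bar>sqrt ((1 - t\<^sup>2) * (1 - r\<^sup>2 * t\<^sup>2)) * j' n t - (1 - t) * (pi / (2 * \<kappa>))\<bar>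
      \<le> sqrt ((1 - t\<^sup>2) * (1 - r\<^sup>2 * t\<^sup>2)) / t\<^sup>2 * C"
    using j'_asymptotic by blast
  have sin: "((\<lambda>x. sin x) \<longlongrightarrow> - 1) ?F"
    using tendsto_sin[OF tendsto_ident_at, of "-pi / 2" "{-pi / 2<..}"] by simp
  have bound: "\<bar>W x - (1 - sin x) * (pi / (2 * \<kappa>))\<bar>
      \<le> sqrt ((1 - (sin x)\<^sup>2) * (1 - r\<^sup>2 * (sin x)\<^sup>2)) / (sin x)\<^sup>2 * C"
    if x: "x \<in> {-pi / 2<..<0}" for x
  proof -
    have "cos x > 0" using x by (intro cos_gt_zero_pi) auto
    then have "cos x = sqrt (1 - (sin x)\<^sup>2)" by (simp add: cos_squared_eq[symmetric])
    then have W: "W x = sqrt ((1 - (sin x)\<^sup>2) * (1 - r\<^sup>2 * (sin x)\<^sup>2)) * j' n (sin x)"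
      by (simp add: W_def real_sqrt_mult)
    have "sin x < 0" using x sin_gt_zero[of "- x"] by simp
    moreover have "(sin x)\<^sup>2 < 1" using \<open>cos x > 0\<close> by (simp add: sin_squared_eq)
    then have "-1 < sin x" by (simp add: abs_square_less_1)
    ultimately show ?thesis unfolding W using C by simp
  qed
  \<comment> \<open>The error bound contains the square root of 1 - (sin x)^2, which tends to
    0.\<close>
  have "((\<lambda>x. W x - (1 - sin x) * (pi / (2 * \<kappa>))) \<longlongrightarrow> 0) ?F"
  proof (rule Lim_null_comparison)
    show "eventually (\<lambda>x. norm (W x - (1 - sin x) * (pi / (2 * \<kappa>)))
        \<le> sqrt ((1 - (sin x)\<^sup>2) * (1 - r\<^sup>2 * (sin x)\<^sup>2)) / (sin x)\<^sup>2 * C) ?F"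
      using near by eventually_elim (use bound in simp)
    have "((\<lambda>x. sqrt ((1 - (sin x)\<^sup>2) * (1 - r\<^sup>2 * (sin x)\<^sup>2)) / (sin x)\<^sup>2 * C) \<longlongrightarrow>
        sqrt ((1 - (-1)\<^sup>2) * (1 - r\<^sup>2 * (-1)\<^sup>2)) / (-1)\<^sup>2 * C) ?F"
      by (intro tendsto_intros sin) simp
    then show "((\<lambda>x. sqrt ((1 - (sin x)\<^sup>2) * (1 - r\<^sup>2 * (sin x)\<^sup>2)) / (sin x)\<^sup>2 * C) \<longlongrightarrow> 0) ?F"
      by simp
  qed
  moreover have "((\<lambda>x. (1 - sin x) * (pi / (2 * \<kappa>))) \<longlongrightarrow> (1 - (-1)) * (pi / (2 * \<kappa>))) ?F"
    by (intro tendsto_intros sin)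
  ultimately have "((\<lambda>x. W x - (1 - sin x) * (pi / (2 * \<kappa>)) + (1 - sin x) * (pi / (2 * \<kappa>))) \<longlongrightarrow>
      0 + (1 - (-1)) * (pi / (2 * \<kappa>))) ?F"
    by (rule tendsto_add)
  then have 2: "(W \<longlongrightarrow> pi / \<kappa>) ?F" by simp
  have "\<nu> * U * sinh (\<nu> * (elliptic_F (-pi / 2) r - elliptic_K r)) = pi / \<kappa>"
    using tendsto_unique[OF _ 1 2] by simp
  moreover have "\<nu> * (elliptic_F (-pi / 2) r - elliptic_K r) = - (2 * \<nu> * elliptic_K r)"
    using elliptic_F_minus[OF r2_less_1, of "pi / 2"] by (simp add: elliptic_K_def)
  ultimately have "\<nu> * U * sinh (2 * \<nu> * elliptic_K r) = - pi / \<kappa>" by simp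
  then have "\<kappa> * (\<nu> * U * sinh (2 * \<nu> * elliptic_K r)) = - pi" using \<kappa>_pos by simp
  moreover have "\<kappa> * \<nu> = real n" using \<kappa>_pos by (simp add: \<nu>_def)
  ultimately have "real n * U * sinh (2 * \<nu> * elliptic_K r) = - pi"
    by (simp only: mult.assoc[symmetric])
  then show ?thesis by (simp only: \<nu>_def U_def)
qed

subsection \<open>The Laplace-type integrals\<close>

lemma borel_measurable_f [measurable]: "f \<in> borel_measurable borel"
  by (intro borel_measurable_continuous_onI continuous_intros)

text \<open>\<open>pi\<close> times \<open>Phi_tilde\<close> on the real axis, as a real-valued
  function.\<close>

definition \<Phi> :: "nat \<Rightarrow> real \<Rightarrow> real" where
  "\<Phi> n x = (LBINT \<theta>:{0..pi}. exp (- x * f \<theta>) * cos (real n * \<theta>))"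

lemma borel_measurable_\<Phi> [measurable]: "\<Phi> n \<in> borel_measurable borel"
  unfolding \<Phi>_def set_lebesgue_integral_def by measurable

lemma Phi_tilde_of_real: "Phi_tilde r n (of_real x) = of_real (\<Phi> n x / pi)"
proof -
  have "(LBINT \<theta>:{0..pi}. exp (- complex_of_real x * of_real (jacobi_dn (elliptic_K k * \<theta> / pi) k)) * of_real (cos (real n * \<theta>)))
      = (LBINT \<theta>:{0..pi}. complex_of_real (exp (- x * f \<theta>) * cos (real n * \<theta>)))"
    by (simp add: f_def \<kappa>_def exp_of_real[symmetric])
  also have "\<dots> = of_real (\<Phi> n x)"
    unfolding \<Phi>_def set_lebesgue_integral_def
    by (subst integral_complex_of_real[symmetric], rule Bochner_Integration.integral_cong)
      (auto split: split_indicator)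
  finally show ?thesis by (simp add: Phi_tilde_def k_eq[symmetric])
qed

text \<open>Factor out \<open>exp (- x * f \<theta>)\<close>, which is at most
  \<open>exp (- r * x)\<close>; the other factor is at most \<open>x\<close> by 1 - exp (- y) \<le>
  y. This cancels the pole at 0.\<close>

lemma exp_f_diff_bound:
  assumes "0 < x"
  shows "0 \<le> (exp (- x * f \<theta>) - exp (- x)) / x" "(exp (- x * f \<theta>) - exp (- x)) / x \<le> exp (- r * x)"
proof -
  have "x * f \<theta> \<le> x * 1" using assms f_le_1 by (intro mult_left_mono) auto
  then show "0 \<le> (exp (- x * f \<theta>) - exp (- x)) / x" using assms by simp
  have "exp (- x * f \<theta>) - exp (- x) = exp (- x * f \<theta>) * (1 - exp (- x * (1 - f \<theta>)))"
    by (simp add: algebra_simps exp_add[symmetric])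
  also have "\<dots> \<le> exp (- r * x) * x"
  proof (rule mult_mono)
    have "r * x \<le> f \<theta> * x" using assms f_ge_r by (intro mult_right_mono) auto
    then show "exp (- x * f \<theta>) \<le> exp (- r * x)" by (simp add: mult.commute)
    have "1 + (- x * (1 - f \<theta>)) \<le> exp (- x * (1 - f \<theta>))" by (rule exp_ge_add_one_self)
    moreover have "0 \<le> x * f \<theta>" using assms f_pos[of \<theta>] by simp
    ultimately show "1 - exp (- x * (1 - f \<theta>)) \<le> x" by (simp add: algebra_simps)
    show "0 \<le> 1 - exp (- x * (1 - f \<theta>))" using assms f_le_1[of \<theta>] by simp
  qed simp
  finally show "(exp (- x * f \<theta>) - exp (- x)) / x \<le> exp (- r * x)" using assms by (simp add: divide_simps)
qed

text \<open>As \<open>cos (n * \<theta>)\<close> has integral zero, \<open>exp (- x)\<close> may be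
  subtracted. The integrand then stays bounded near \<open>x = 0\<close> and has Frullani
  form.\<close>

lemma \<Phi>_div:
  assumes n: "n \<ge> 1" and x: "0 < x"
  shows "\<Phi> n x / x = (LBINT \<theta>:{0..pi}. (exp (- x * f \<theta>) - exp (- x)) / x * cos (real n * \<theta>))"
proof -
  have "((\<lambda>\<theta>. exp (- x * f \<theta>) * cos (real n * \<theta>)) has_integral \<Phi> n x) {0..pi}"
    unfolding \<Phi>_def
    by (subst LBINT_eq_integral) (auto intro!: continuous_intros integrable_integral integrable_continuous_real)
  then have "((\<lambda>\<theta>. (exp (- x * f \<theta>) * cos (real n * \<theta>) - exp (- x) * cos (real n * \<theta>)) / x)
      has_integral (\<Phi> n x - exp (- x) * 0) / x) {0..pi}"
    by (intro has_integral_divide has_integral_diff has_integral_mult_right integral_cos_nat_0_pi n)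
  moreover have "(exp (- x * f \<theta>) * cos (real n * \<theta>) - exp (- x) * cos (real n * \<theta>)) / x
      = (exp (- x * f \<theta>) - exp (- x)) / x * cos (real n * \<theta>)" for \<theta>
    by (simp add: algebra_simps)
  ultimately have "((\<lambda>\<theta>. (exp (- x * f \<theta>) - exp (- x)) / x * cos (real n * \<theta>)) has_integral \<Phi> n x / x) {0..pi}"
    by (simp only: mult_zero_right diff_zero)
  moreover have "continuous_on {0..pi} (\<lambda>\<theta>. (exp (- x * f \<theta>) - exp (- x)) / x * cos (real n * \<theta>))"
    using x by (auto intro!: continuous_intros)
  ultimately show ?thesis by (simp only: LBINT_eq_integral integral_unique)
qed

lemma \<Phi>_div_bound:
  assumes n: "n \<ge> 1" and x: "0 < x"
  shows "\<bar>\<Phi> n x / x\<bar> \<le> pi"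
proof -
  have "norm (integral {0..pi} (\<lambda>\<theta>. (exp (- x * f \<theta>) - exp (- x)) / x * cos (real n * \<theta>))) \<le> 1 * (pi - 0)"
  proof (rule integral_bound)
    fix \<theta> assume "\<theta> \<in> {0..pi}"
    note b = exp_f_diff_bound[OF x, of \<theta>]
    have "\<bar>(exp (- x * f \<theta>) - exp (- x)) / x\<bar> * \<bar>cos (real n * \<theta>)\<bar> \<le> exp (- r * x) * 1"
      using b by (intro mult_mono) auto
    also have "\<dots> \<le> 1" using r_pos x by simp
    finally show "norm ((exp (- x * f \<theta>) - exp (- x)) / x * cos (real n * \<theta>)) \<le> 1" by (simp add: abs_mult)
  qed (use x in \<open>auto intro!: continuous_intros\<close>)
  then show ?thesis
    unfolding \<Phi>_div[OF n x] using x by (subst LBINT_eq_integral) (auto intro!: continuous_intros)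
qed

text \<open>After the interchange, Frullani's integral with rates c + f \<le> c + 1 gives ln ((c +
  1) / c) - ln (1 + f / c). The first logarithm is constant in \<open>\<theta>\<close> and
  integrates to zero against the cosine.\<close>

lemma laplace_\<Phi>_div:
  assumes n: "n \<ge> 1" and c: "0 < c"
  shows "(LBINT x:{0<..}. exp (- x * c) * (\<Phi> n x / x)) = - j n (1 / c)"
proof -
  let ?h = "\<lambda>x \<theta>. exp (- x * c) * ((exp (- x * f \<theta>) - exp (- x)) / x * cos (real n * \<theta>))"
  have "(LBINT x:{0<..}. exp (- x * c) * (\<Phi> n x / x)) = (LBINT x:{0<..}. LBINT \<theta>:{0..pi}. ?h x \<theta>)"
    by (rule set_lebesgue_integral_cong) (auto simp: \<Phi>_div[OF n])
  also have "\<dots> = (LBINT \<theta>:{0..pi}. LBINT x:{0<..}. ?h x \<theta>)"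
  proof (rule Fubini_exp_bound(2)[OF _ r_pos, where C = 1])
    show "(\<lambda>(x, \<theta>). ?h x \<theta>) \<in> borel_measurable (lborel \<Otimes>\<^sub>M lborel)" by measurable
    fix x \<theta> :: real assume x: "0 < x"
    note b = exp_f_diff_bound[OF x, of \<theta>]
    have "exp (- x * c) * (\<bar>(exp (- x * f \<theta>) - exp (- x)) / x\<bar> * \<bar>cos (real n * \<theta>)\<bar>) \<le> 1 * (exp (- r * x) * 1)"
      using b x c by (intro mult_mono) auto
    then show "\<bar>?h x \<theta>\<bar> \<le> 1 * exp (- r * x)" by (simp add: abs_mult)
  qed
  also have "\<dots> = (LBINT \<theta>:{0..pi}. (ln ((c + 1) / c) - ln (1 + 1 / c * f \<theta>)) * cos (real n * \<theta>))"
  proof (rule set_lebesgue_integral_cong, simp, intro allI impI)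
    fix \<theta> :: real
    have cf: "0 < c + f \<theta>" "c + f \<theta> \<le> c + 1" using c f_pos[of \<theta>] f_le_1[of \<theta>] by auto
    have "(LBINT x:{0<..}. ?h x \<theta>) = (LBINT x:{0<..}. (exp (- (c + f \<theta>) * x) - exp (- (c + 1) * x)) / x * cos (real n * \<theta>))"
      by (rule set_lebesgue_integral_cong) (auto simp: algebra_simps exp_add[symmetric] exp_diff[symmetric] exp_minus[symmetric])
    also have "\<dots> = ln ((c + 1) / (c + f \<theta>)) * cos (real n * \<theta>)"
      by (simp only: set_integral_mult_left frullani_exp[OF cf])
    also have "ln ((c + 1) / (c + f \<theta>)) = ln ((c + 1) / c) - ln (1 + 1 / c * f \<theta>)"
    proof -
      have "1 + 1 / c * f \<theta> = (c + f \<theta>) / c" using c by (simp add: field_simps)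
      then show ?thesis using c cf by (simp add: ln_div)
    qed
    finally show "(LBINT x:{0<..}. ?h x \<theta>) = (ln ((c + 1) / c) - ln (1 + 1 / c * f \<theta>)) * cos (real n * \<theta>)" .
  qed
  also have "\<dots> = - j n (1 / c)"
  proof -
    have pos: "0 < 1 + 1 / c * f \<theta>" for \<theta> using c f_pos[of \<theta>] by (simp add: add_pos_pos)
    have J: "((\<lambda>\<theta>. ln (1 + 1 / c * f \<theta>) * cos (real n * \<theta>)) has_integral j n (1 / c)) {0..pi}"
      unfolding j_def using pos
      by (intro integrable_integral integrable_continuous_real continuous_intros) (auto simp: less_imp_neq[symmetric])
    have "((\<lambda>\<theta>. ln ((c + 1) / c) * cos (real n * \<theta>) - ln (1 + 1 / c * f \<theta>) * cos (real n * \<theta>))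
        has_integral ln ((c + 1) / c) * 0 - j n (1 / c)) {0..pi}"
      by (intro has_integral_diff has_integral_mult_right integral_cos_nat_0_pi n J)
    moreover have "continuous_on {0..pi} (\<lambda>\<theta>. (ln ((c + 1) / c) - ln (1 + 1 / c * f \<theta>)) * cos (real n * \<theta>))"
      using pos c by (intro continuous_intros) (simp_all add: less_imp_neq[symmetric])
    ultimately show ?thesis by (simp add: LBINT_eq_integral integral_unique left_diff_distrib)
  qed
  finally show ?thesis .
qed

text \<open>Expand \<open>\<Phi> m\<close> as an integral over \<open>\<phi>\<close> and
  interchange. The inner integral is \<open>- j n (1 / f \<phi>)\<close>, a multiple of
  \<open>cos (n * \<phi>)\<close> plus a constant, so orthogonality of the cosines finishes the
  evaluation.\<close>

lemma \<Phi>_integral: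
  assumes m: "m \<ge> 1" and n: "n \<ge> 1"
  shows "set_integrable lborel {0<..} (\<lambda>x. \<Phi> m x * (\<Phi> n x / x))"
    and "(LBINT x:{0<..}. \<Phi> m x * (\<Phi> n x / x)) =
      - (j n 1 - \<gamma> n / (real n / \<kappa>)\<^sup>2) * (if m = n then pi / 2 else 0)"
proof -
  let ?h = "\<lambda>x \<phi>. exp (- x * f \<phi>) * cos (real m * \<phi>) * (\<Phi> n x / x)"
  let ?U = "j n 1 - \<gamma> n / (real n / \<kappa>)\<^sup>2"
  have hm: "(\<lambda>(x, \<phi>). ?h x \<phi>) \<in> borel_measurable (lborel \<Otimes>\<^sub>M lborel)" by measurable
  have hb: "\<bar>?h x \<phi>\<bar> \<le> pi * exp (- r * x)" if x: "0 < x" for x \<phi>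
  proof -
    have "r * x \<le> f \<phi> * x" using x f_ge_r by (intro mult_right_mono) auto
    then have "exp (- x * f \<phi>) * \<bar>cos (real m * \<phi>)\<bar> * \<bar>\<Phi> n x / x\<bar> \<le> exp (- r * x) * 1 * pi"
      using \<Phi>_div_bound[OF n x] by (intro mult_mono) (auto simp: mult.commute)
    then show ?thesis by (simp add: abs_mult mult.commute)
  qed
  have e: "(LBINT \<phi>:{0..pi}. ?h x \<phi>) = \<Phi> m x * (\<Phi> n x / x)" for x
    by (simp only: \<Phi>_def[of m] set_integral_mult_left)
  show "set_integrable lborel {0<..} (\<lambda>x. \<Phi> m x * (\<Phi> n x / x))"
    using Fubini_exp_bound(1)[OF hm r_pos hb, of pi] by (simp only: e)
  have "(LBINT x:{0<..}. \<Phi> m x * (\<Phi> n x / x)) = (LBINT \<phi>:{0..pi}. LBINT x:{0<..}. ?h x \<phi>)"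
    using Fubini_exp_bound(2)[OF hm r_pos hb, of pi] by (simp only: e)
  also have "\<dots> = (LBINT \<phi>:{0..pi}. - ?U * (cos (real m * \<phi>) * cos (real n * \<phi>))
      - \<gamma> n / (real n / \<kappa>)\<^sup>2 * cos (real m * \<phi>))"
  proof (rule set_lebesgue_integral_cong, simp, intro allI impI)
    fix \<phi> :: real
    have "?h x \<phi> = cos (real m * \<phi>) * (exp (- x * f \<phi>) * (\<Phi> n x / x))" for x by simp
    then have "(LBINT x:{0<..}. ?h x \<phi>) = cos (real m * \<phi>) * (LBINT x:{0<..}. exp (- x * f \<phi>) * (\<Phi> n x / x))"
      by (simp only: set_integral_mult_right)
    also have "\<dots> = cos (real m * \<phi>) * - j n (1 / f \<phi>)"
      by (simp only: laplace_\<Phi>_div[OF n f_pos])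
    also have "j n (1 / f \<phi>) = ?U * cos (real n * \<phi>) + \<gamma> n / (real n / \<kappa>)\<^sup>2"
      using j_reciprocal_f[OF n, of \<phi>] by linarith
    finally show "(LBINT x:{0<..}. ?h x \<phi>) = - ?U * (cos (real m * \<phi>) * cos (real n * \<phi>))
        - \<gamma> n / (real n / \<kappa>)\<^sup>2 * cos (real m * \<phi>)"
      by (simp add: algebra_simps)
  qed
  also have "\<dots> = - ?U * (if m = n then pi / 2 else 0) - \<gamma> n / (real n / \<kappa>)\<^sup>2 * 0"
    by (subst LBINT_eq_integral, intro continuous_intros, rule integral_unique,
        intro has_integral_diff has_integral_mult_right integral_cos_cos_0_pi integral_cos_nat_0_pi m n)
  finally show "(LBINT x:{0<..}. \<Phi> m x * (\<Phi> n x / x)) = - ?U * (if m = n then pi / 2 else 0)"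
    by simp
qed

end

section \<open>Expressing the value through the nome \<open>q\<close>\<close>

theorem theorem3p20:
  fixes r k q :: real and m n :: nat
  assumes "0 < r" and "r < 1"
    and "k = sqrt (1 - r\<^sup>2)"
    and "q = exp (- pi * elliptic_K r / elliptic_K k)"
    and "m \<ge> 1" and "n \<ge> 1"
  shows "set_integrable lborel {0<..}
           (\<lambda>x::real. Phi_tilde r m (of_real x) * Phi_tilde r n (of_real x) * (1 / of_real x))
    \<and> (LBINT x:{0<..}. Phi_tilde r m (of_real x) * Phi_tilde r n (of_real x) * (1 / of_real x))
      = (if m \<noteq> n then 0
         else of_real (1 / real n * (1 / (q powi (- 2 * int n) - q ^ (2 * n)))))"
proof -
  interpret complementary_moduli r k by unfold_locales fact+
  define U where "U = j n 1 - \<gamma> n / (real n / \<kappa>)\<^sup>2"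
  define S where "S = sinh (2 * (real n / \<kappa>) * elliptic_K r)"
  have S: "S > 0"
    using \<kappa>_pos elliptic_K_pos[OF r2_less_1] \<open>n \<ge> 1\<close> by (simp add: S_def)
  have "real n * U * S = - pi"
    unfolding U_def S_def by (rule j_1[OF \<open>n \<ge> 1\<close>])
  then have U: "U = - pi / (real n * S)" using S \<open>n \<ge> 1\<close> by (simp add: field_simps)
  \<comment> \<open>As \<open>\<kappa>\<close> is \<open>K(k) / pi\<close>, the exponent of
    \<open>q\<close> is \<open>- K(r) / \<kappa>\<close>; hence the difference of the powers of
    \<open>q\<close> is twice the hyperbolic sine \<open>S\<close>.\<close>
  have "q = exp (- (elliptic_K r / \<kappa>))" using assms(4) by (simp add: \<kappa>_def)
  then have q: "q ^ (2 * n) = exp (- (2 * (real n / \<kappa>) * elliptic_K r))"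
    by (simp add: exp_of_nat_mult[symmetric])
  have "q powi (- 2 * int n) = inverse (q ^ (2 * n))"
    using power_int_minus[of q "int (2 * n)"] by (simp only: power_int_of_nat) simp
  then have qS: "q powi (- 2 * int n) - q ^ (2 * n) = 2 * S"
    by (simp add: q exp_minus[symmetric] S_def sinh_def)
  have eq: "Phi_tilde r m (of_real x) * Phi_tilde r n (of_real x) * (1 / of_real x)
      = complex_of_real (\<Phi> m x * (\<Phi> n x / x) / pi\<^sup>2)" for x
    by (simp add: Phi_tilde_of_real power2_eq_square)
  \<comment> \<open>The value of a Lebesgue integral alone would not show convergence, since
    nonintegrable functions get the integral 0 by default.\<close>
  have int: "set_integrable lborel {0<..} (\<lambda>x. \<Phi> m x * (\<Phi> n x / x) / pi\<^sup>2)"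
    using \<Phi>_integral(1)[OF \<open>m \<ge> 1\<close> \<open>n \<ge> 1\<close>] by (rule set_integrable_divide)
  have "(LBINT x:{0<..}. \<Phi> m x * (\<Phi> n x / x) / pi\<^sup>2) = - U * (if m = n then pi / 2 else 0) / pi\<^sup>2"
    unfolding set_integral_divide_zero \<Phi>_integral(2)[OF \<open>m \<ge> 1\<close> \<open>n \<ge> 1\<close>] U_def ..
  \<comment> \<open>For \<open>m = n\<close> the factors \<open>pi\<close> cancel: - U (pi / 2) /
    pi^2 = 1 / (2 n S).\<close>
  also have "\<dots> = (if m \<noteq> n then 0 else 1 / real n * (1 / (2 * S)))"
    unfolding U using S \<open>n \<ge> 1\<close> by (simp add: field_simps power2_eq_square)
  finally have val: "(LBINT x:{0<..}. \<Phi> m x * (\<Phi> n x / x) / pi\<^sup>2)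
    = (if m \<noteq> n then 0 else 1 / real n * (1 / (2 * S)))" .
  have "set_integrable lborel {0<..} (\<lambda>x. complex_of_real (\<Phi> m x * (\<Phi> n x / x) / pi\<^sup>2))"
    using int unfolding set_integrable_def
    by (subst (asm) complex_of_real_integrable_eq[symmetric]) (simp add: scaleR_conv_of_real)
  moreover have "(LBINT x:{0<..}. complex_of_real (\<Phi> m x * (\<Phi> n x / x) / pi\<^sup>2))
      = of_real (LBINT x:{0<..}. \<Phi> m x * (\<Phi> n x / x) / pi\<^sup>2)"
    unfolding set_lebesgue_integral_def
    by (subst integral_complex_of_real[symmetric]) (simp add: scaleR_conv_of_real)
  ultimately show ?thesis
    unfolding eq val qS by simp
qed

end
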